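(* Let $q$ be a prime power and $m>4$ an integer. Let $k=\binom{m}{2}$, $n=\left[{m\atop 2}\right]_q$, $\delta=2(m-2)$ and $\mu=m-1$. Then the Grassmann code $C(2,m)$ satisfies $$d_{k-\mu-1}(C(2,m))=n-(1+q+\cdots+q^{\mu-1}+q^2)$$ and $$d_{\mu+1}(C(2,m))=q^{\delta}+q^{\delta-1}+2q^{\delta-2}+q^{\delta-3}+\cdots+q^{\delta-\mu+1},$$ i.e. $d_{\mu+1}(C(2,m))=\sum_{j=0}^{\mu-1}q^{\delta-j}+q^{\delta-2}$.
   Context: For a linear code $C\subseteq\mathbb F_q^n$ and $D\subseteq \mathbb F_q^n$, $\mathrm{supp}(D)=\{i: x_i\neq 0\text{ for some }x\in D\}$ and $\|D\|=|\mathrm{supp}(D)|$; the $r$-th higher weight is $d_r(C)=\min\{\|D\|: D\text{ a subspace of }C,\ \dim D=r\}$. The Gaussian binomial coefficient is $\left[{m\atop \ell}\right]_q=\prod_{i=0}^{\ell-1}\frac{q^m-q^i}{q^\ell-q^i}$. Grassmann code: let $V=\mathbb F_q^m$ with fixed basis $e_1,\dots,e_m$, identify $\bigwedge^mV$ with $\mathbb F_q$ via $e_1\wedge\cdots\wedge e_m=1$. Let $\omega'_1,\dots,\omega'_n\in\bigwedge^{\ell}V$ be fixed representatives (nonzero decomposable vectors $v_1\wedge\cdots\wedge v_\ell$), one for each $\ell$-dimensional subspace of $V$ (so $n=\left[{m\atop \ell}\right]_q$). The map $\tau:\bigwedge^{m-\ell}V\to\mathbb F_q^n$, $\tau(\omega)=(\omega'_1\wedge\omega,\dots,\omega'_n\wedge\omega)$,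 is injective and $C(\ell,m)$ is its image, an $[n,\binom{m}{\ell}]_q$ linear code. Here $\ell=2$. *)

theory Defs
  imports Complex_Main "HOL-Library.Function_Algebras"
begin

text \<open>Vectors of V = F^m are functions nat => F vanishing outside {0..<m};
 coordinate i corresponds to basis vector e_(i+1).\<close>

definition vecs :: "nat \<Rightarrow> (nat \<Rightarrow> 'a::field) set" where
  "vecs m = {x. \<forall>i\<ge>m. x i = 0}"

definition span2 :: "(nat \<Rightarrow> 'a::field) \<Rightarrow> (nat \<Rightarrow> 'a) \<Rightarrow> (nat \<Rightarrow> 'a) set" where
  "span2 u v = {(\<lambda>i. a * u i + b * v i) | a b. True}"

definition indep2 :: "(nat \<Rightarrow> 'a::field) \<Rightarrow> (nat \<Rightarrow> 'a) \<Rightarrow> bool" where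
  "indep2 u v \<longleftrightarrow> (\<forall>a b. (\<forall>i. a * u i + b * v i = 0) \<longrightarrow> a = 0 \<and> b = 0)"

definition Gr2 :: "nat \<Rightarrow> (nat \<Rightarrow> 'a::field) set set" where
  "Gr2 m = {span2 u v | u v. u \<in> vecs m \<and> v \<in> vecs m \<and> indep2 u v}"

text \<open>Fixed representative (a basis u, v, i.e. the decomposable vector u wedge v) of each point.\<close>
definition rep2 :: "nat \<Rightarrow> (nat \<Rightarrow> 'a::field) set \<Rightarrow> (nat \<Rightarrow> 'a) \<times> (nat \<Rightarrow> 'a)" where
  "rep2 m W = (SOME p. fst p \<in> vecs m \<and> snd p \<in> vecs m \<and> indep2 (fst p) (snd p)
                       \<and> W = span2 (fst p) (snd p))"

text \<open>Pairing of the representative u wedge v with a general element of the dual of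
 wedge^2 V (equivalently, via wedge-product, an element of wedge^(m-2) V):
 sum over i<j of a i j times the Pluecker coordinate u_i v_j - u_j v_i.\<close>
definition grass_word :: "nat \<Rightarrow> (nat \<Rightarrow> nat \<Rightarrow> 'a::field) \<Rightarrow> ((nat \<Rightarrow> 'a) set \<Rightarrow> 'a)" where
  "grass_word m a = (\<lambda>W. if W \<in> Gr2 m then
      (let (u, v) = rep2 m W in
        \<Sum>i<m. \<Sum>j\<in>{i<..<m}. a i j * (u i * v j - u j * v i))
     else 0)"

definition grass_code2 :: "nat \<Rightarrow> ((nat \<Rightarrow> 'a::field) set \<Rightarrow> 'a) set" where
  "grass_code2 m = range (grass_word m)"

definition cscale :: "'a::field \<Rightarrow> ('b \<Rightarrow> 'a) \<Rightarrow> ('b \<Rightarrow> 'a)" where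
  "cscale c x = (\<lambda>i. c * x i)"

definition supp_set :: "('b \<Rightarrow> 'a::zero) set \<Rightarrow> 'b set" where
  "supp_set D = {i. \<exists>x\<in>D. x i \<noteq> 0}"

definition is_subspace_dim :: "('b \<Rightarrow> 'a::field) set \<Rightarrow> nat \<Rightarrow> bool" where
  "is_subspace_dim D r \<longleftrightarrow> module.subspace cscale D \<and>
     (\<exists>B. finite B \<and> card B = r \<and> \<not> module.dependent cscale B \<and> module.span cscale B = D)"

definition higher_weight :: "('b \<Rightarrow> 'a::field) set \<Rightarrow> nat \<Rightarrow> nat" where
  "higher_weight C r = Inf {card (supp_set D) | D. D \<subseteq> C \<and> is_subspace_dim D r}"

definition gauss_binom :: "nat \<Rightarrow> nat \<Rightarrow> nat \<Rightarrow> nat" where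
  "gauss_binom q m l = (\<Prod>i<l. q ^ m - q ^ i) div (\<Prod>i<l. q ^ l - q ^ i)"

end

(* A code word is the restriction of an alternating form A to the points of the Grassmannian,
   and forms and bivectors are both stored as alternating matrices.  For an m-dimensional
   space D of forms, double counting gives that the number of pairs (x, y) on which all of D
   vanishes is the sum of |ker A| over D, and |ker A| is q^(m-2) for A decomposable and at most
   q^(m-4) for other nonzero A.  For D of codimension m, the points off the support of D are
   the decomposable elements of the orthogonal space, up to scalars.  So both weights come down
   to one fact: an m-dimensional space of bivectors contains at most
   q^(m-1) + q^3 - q^2 - 1 nonzero decomposable ones.

   To see this, let D_u be the set of elements of D divisible by u.  A coset of D_u other than
   D_u itself contains at most q^2 decomposables, because v/\w + u/\x is decomposable only if x
   lies in <u, v, w>.  If |D_u| = q^a with 3 <= a <= m-1 this gives the bound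
   q^a - 1 + q^2 (q^(m-a) - 1), largest at the ends a = 3 and a = m-1.  If all |D_u| <= q^2, fix
   a decomposable f in D: at most q^3 - 1 nonzero elements of D share a line with f, and any
   other decomposable is the only one on its affine line in direction f.  Equality holds for
   the span of e_0/\V and e_1/\e_2. *)

theory Submission
  imports Defs "HOL-Library.Cardinality" "HOL-Library.FuncSet"
begin

section \<open>Counting in finite coordinate spaces\<close>

text \<open>Dimension and rank enter only as cardinalities: a dimension as the exponent of a power
  of q, the rank of a form through the size of its kernel. Kernels are bounded above by exhibiting
  vectors whose span meets them trivially and below by counting linear conditions, so inequalities
  replace a normal form of alternating matrices.

  In the bound on the kernel sum, trading another nonzero form for a decomposable one gains q^(m-2)
  - q^(m-4). So a space with the maximal number of decomposables is optimal once its other nonzero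
  forms have rank 4. The extremal space has both properties; it settles dimension m, and its
  orthogonal space settles codimension m.

  All regimes of the bound give one constant: q^3 - 1 + q^2 (q^(m-3) - 1) for a = 3, q^(m-1) - 1 +
  q^2 (q - 1) for a = m-1, and (q^m - q^3)/q + q^3 - 1 when no |D_u| exceeds q^2. In the last case
  q^3 bounds the union of the q + 1 spaces D_x with x on the line of f: each has at most q^2
  elements and all contain the q multiples of f.\<close>

interpretation fs: vector_space "cscale :: 'a::field \<Rightarrow> ('b \<Rightarrow> 'a) \<Rightarrow> 'b \<Rightarrow> 'a"
  by unfold_locales (auto simp: cscale_def fun_eq_iff algebra_simps)

lemma CARD_field_ge_2: "CARD('a::{finite,field}) \<ge> 2"
proof -
  have "card {0, 1::'a} \<le> CARD('a)" by (intro card_mono) auto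
  then show ?thesis by simp
qed

lemma card_span_independent:
  fixes B :: "('b \<Rightarrow> 'a::{finite,field}) set"
  assumes "finite B" "fs.independent B"
  shows "finite (fs.span B) \<and> card (fs.span B) = CARD('a) ^ card B"
  using assms
proof (induction B rule: finite_induct)
  case empty
  then show ?case by simp
next
  case (insert b B)
  then have ind: "fs.independent B" and b: "b \<notin> fs.span B"
    by (auto simp: fs.independent_insert)
  let ?h = "\<lambda>(c::'a, x). cscale c b + x"
  have img: "fs.span (insert b B) = ?h ` (UNIV \<times> fs.span B)"
  proof (intro equalityI subsetI)
    fix x assume "x \<in> fs.span (insert b B)"
    then obtain k where k: "x - cscale k b \<in> fs.span B" by (auto simp: fs.span_insert)
    show "x \<in> ?h ` (UNIV \<times> fs.span B)"
      by (rule image_eqI[of _ _ "(k, x - cscale k b)"]) (use k in auto)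
  next
    fix x assume "x \<in> ?h ` (UNIV \<times> fs.span B)"
    then show "x \<in> fs.span (insert b B)"
      by (auto intro!: fs.span_add fs.span_scale intro: fs.span_base fs.span_mono[THEN subsetD, of B])
  qed
  have "inj_on ?h (UNIV \<times> fs.span B)"
  proof (rule inj_onI, clarsimp)
    fix c d :: 'a and x y
    assume xy: "x \<in> fs.span B" "y \<in> fs.span B" and eq: "cscale c b + x = cscale d b + y"
    have e: "cscale (c - d) b = y - x" using eq by (simp add: fs.scale_left_diff_distrib algebra_simps)
    have "c = d"
    proof (rule ccontr)
      assume "c \<noteq> d"
      then have "b = cscale (inverse (c - d)) (y - x)" by (simp flip: e)
      then show False using b xy by (metis fs.span_diff fs.span_scale)
    qed
    then show "c = d \<and> x = y" using eq by simp
  qed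
  then have "card (fs.span (insert b B)) = CARD('a) * card (fs.span B)"
    unfolding img by (simp add: card_image card_cartesian_product)
  moreover have "finite (fs.span (insert b B))" unfolding img using insert.IH ind by simp
  ultimately show ?case using insert ind by simp
qed

lemma subspace_card_power:
  fixes S :: "('b \<Rightarrow> 'a::{finite,field}) set"
  assumes "fs.subspace S" "finite S"
  obtains r where "card S = CARD('a) ^ r" "is_subspace_dim S r"
proof -
  obtain B where B: "B \<subseteq> S" "fs.independent B" "S \<subseteq> fs.span B"
    using fs.maximal_independent_subset[of S] by blast
  have "finite B" using B assms(2) finite_subset by blast
  moreover have "fs.span B = S" using B assms(1) fs.span_minimal by blast
  ultimately show ?thesis using that[of "card B"] card_span_independent[of B] B assms(1)
    unfolding is_subspace_dim_def by metis
qed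

text \<open>Dimension becomes cardinality, since q \<ge> 2 makes the exponent in q^r unique. From
  here on a space of dimension r is handled as a subspace with q^r elements.\<close>

lemma is_subspace_dim_iff:
  fixes S :: "('b \<Rightarrow> 'a::{finite,field}) set"
  shows "is_subspace_dim S r \<longleftrightarrow> fs.subspace S \<and> finite S \<and> card S = CARD('a) ^ r"
proof
  assume "is_subspace_dim S r"
  then show "fs.subspace S \<and> finite S \<and> card S = CARD('a) ^ r"
    unfolding is_subspace_dim_def using card_span_independent by metis
next
  assume *: "fs.subspace S \<and> finite S \<and> card S = CARD('a) ^ r"
  then obtain s where "card S = CARD('a) ^ s" "is_subspace_dim S s" using subspace_card_power by blast
  moreover have "CARD('a) \<ge> 2" by (rule CARD_field_ge_2)
  ultimately show "is_subspace_dim S r" using * by (metis power_inject_exp Suc_1 Suc_le_lessD)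
qed

text \<open>\<open>S\<close> is the direct sum of the line through \<open>x0\<close> and the kernel,
  with coefficient \<open>\<phi> x / \<phi> x0\<close> on that line.\<close>

lemma card_functional_kernel:
  fixes S :: "('b \<Rightarrow> 'a::{finite,field}) set" and \<phi> :: "('b \<Rightarrow> 'a) \<Rightarrow> 'a"
  assumes S: "fs.subspace S"
    and add: "\<And>x y. x \<in> S \<Longrightarrow> y \<in> S \<Longrightarrow> \<phi> (x + y) = \<phi> x + \<phi> y"
    and scale: "\<And>c x. x \<in> S \<Longrightarrow> \<phi> (cscale c x) = c * \<phi> x"
    and x0: "x0 \<in> S" "\<phi> x0 \<noteq> 0"
  shows "card S = CARD('a) * card {x \<in> S. \<phi> x = 0}"
proof -
  let ?K = "{x \<in> S. \<phi> x = 0}" and ?h = "\<lambda>(c::'a, x). cscale c x0 + x"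
  have sub: "\<phi> (x - cscale c x0) = \<phi> x - c * \<phi> x0" if "x \<in> S" for x c
    using add[of x "cscale (- c) x0"] scale[of x0 "- c"] that x0 S by (simp add: fs.subspace_scale fs.subspace_neg)
  have "bij_betw ?h (UNIV \<times> ?K) S"
  proof (rule bij_betw_byWitness[where f' = "\<lambda>x. (\<phi> x / \<phi> x0, x + cscale (- (\<phi> x / \<phi> x0)) x0)"])
    show "\<forall>a\<in>UNIV \<times> ?K. (\<lambda>x. (\<phi> x / \<phi> x0, x + cscale (- (\<phi> x / \<phi> x0)) x0)) (?h a) = a"
      using x0 S by (auto simp: add scale fs.subspace_scale)
    show "\<forall>a\<in>S. ?h ((\<lambda>x. (\<phi> x / \<phi> x0, x + cscale (- (\<phi> x / \<phi> x0)) x0)) a) = a" by auto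
    show "?h ` (UNIV \<times> ?K) \<subseteq> S" using S x0 by (auto intro!: fs.subspace_add fs.subspace_scale)
    show "(\<lambda>x. (\<phi> x / \<phi> x0, x + cscale (- (\<phi> x / \<phi> x0)) x0)) ` S \<subseteq> UNIV \<times> ?K"
      using S x0 by (auto simp: sub fs.subspace_scale fs.subspace_diff)
  qed
  then show ?thesis using bij_betw_same_card by (fastforce simp: card_cartesian_product)
qed

lemma card_functional_kernel_le:
  fixes S :: "('b \<Rightarrow> 'a::{finite,field}) set" and \<phi> :: "('b \<Rightarrow> 'a) \<Rightarrow> 'a"
  assumes S: "fs.subspace S"
    and add: "\<And>x y. x \<in> S \<Longrightarrow> y \<in> S \<Longrightarrow> \<phi> (x + y) = \<phi> x + \<phi> y"
    and scale: "\<And>c x. x \<in> S \<Longrightarrow> \<phi> (cscale c x) = c * \<phi> x"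
  shows "card S \<le> CARD('a) * card {x \<in> S. \<phi> x = 0}"
proof (cases "\<exists>x0\<in>S. \<phi> x0 \<noteq> 0")
  case True
  then show ?thesis using card_functional_kernel[OF S] add scale by (metis (no_types, lifting) order_refl)
next
  case False
  then have "{x \<in> S. \<phi> x = 0} = S" by auto
  moreover have "card S \<le> CARD('a) * card S" by simp
  ultimately show ?thesis by simp
qed

text \<open>For fixed y the zeros in x form all of \<open>S\<close> or a hyperplane with |S|/q
  elements; the factor q clears that denominator. \<open>Y\<close> is a mere finite set, without
  linearity in y, so that it can later consist of pairs (x, y) or (A, x).\<close>

lemma double_count_zeros:
  fixes S :: "('b \<Rightarrow> 'a::{finite,field}) set" and \<beta> :: "('b \<Rightarrow> 'a) \<Rightarrow> 'y \<Rightarrow> 'a"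
  assumes S: "fs.subspace S" "finite S" and Y: "finite Y"
    and add: "\<And>x x' y. x \<in> S \<Longrightarrow> x' \<in> S \<Longrightarrow> y \<in> Y \<Longrightarrow> \<beta> (x + x') y = \<beta> x y + \<beta> x' y"
    and scale: "\<And>c x y. x \<in> S \<Longrightarrow> y \<in> Y \<Longrightarrow> \<beta> (cscale c x) y = c * \<beta> x y"
  shows "CARD('a) * card {(x, y) \<in> S \<times> Y. \<beta> x y = 0}
           = card S * (card Y + (CARD('a) - 1) * card {y \<in> Y. \<forall>x\<in>S. \<beta> x y = 0})"
proof -
  let ?q = "CARD('a)" and ?Y0 = "{y \<in> Y. \<forall>x\<in>S. \<beta> x y = 0}"
  have "{(x, y) \<in> S \<times> Y. \<beta> x y = 0} = prod.swap ` (SIGMA y:Y. {x \<in> S. \<beta> x y = 0})" by auto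
  then have "card {(x, y) \<in> S \<times> Y. \<beta> x y = 0} = (\<Sum>y\<in>Y. card {x \<in> S. \<beta> x y = 0})"
    using S Y by (simp add: card_image)
  then have "?q * card {(x, y) \<in> S \<times> Y. \<beta> x y = 0} = (\<Sum>y\<in>Y. ?q * card {x \<in> S. \<beta> x y = 0})"
    by (simp add: sum_distrib_left)
  also have "\<dots> = (\<Sum>y\<in>Y. card S + (if y \<in> ?Y0 then (?q - 1) * card S else 0))"
  proof (rule sum.cong)
    fix y assume y: "y \<in> Y"
    show "?q * card {x \<in> S. \<beta> x y = 0} = card S + (if y \<in> ?Y0 then (?q - 1) * card S else 0)"
    proof (cases "y \<in> ?Y0")
      case True
      then have "{x \<in> S. \<beta> x y = 0} = S" by auto
      then show ?thesis using True CARD_field_ge_2[where 'a='a] by (simp add: diff_mult_distrib)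
    next
      case False
      then obtain x0 where "x0 \<in> S" "\<beta> x0 y \<noteq> 0" using y by blast
      then have "card S = ?q * card {x \<in> S. \<beta> x y = 0}"
        using card_functional_kernel[OF S(1), of "\<lambda>x. \<beta> x y" x0] add scale y by blast
      then show ?thesis using False by (simp only: if_False)
    qed
  qed simp
  also have "\<dots> = card S * card Y + card ?Y0 * ((?q - 1) * card S)"
    using Y by (simp add: sum.distrib sum.If_cases Int_def)
  finally show ?thesis by (simp add: algebra_simps)
qed

text \<open>The zero pairs of \<beta> are counted by \<open>double_count_zeros\<close> from both
  sides. Seen from \<open>Y\<close>, nondegeneracy leaves x = 0 as the only common zero, and
  comparing the two counts gives the product formula.\<close>

lemma card_annihilator:
  fixes D X :: "('b \<Rightarrow> 'a::{finite,field}) set" and Y :: "('c \<Rightarrow> 'a) set"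
    and \<beta> :: "('b \<Rightarrow> 'a) \<Rightarrow> ('c \<Rightarrow> 'a) \<Rightarrow> 'a"
  assumes D: "fs.subspace D" "finite D" and Y: "fs.subspace Y" "finite Y"
    and add1: "\<And>x x' y. x \<in> D \<Longrightarrow> x' \<in> D \<Longrightarrow> y \<in> Y \<Longrightarrow> \<beta> (x + x') y = \<beta> x y + \<beta> x' y"
    and scale1: "\<And>c x y. x \<in> D \<Longrightarrow> y \<in> Y \<Longrightarrow> \<beta> (cscale c x) y = c * \<beta> x y"
    and add2: "\<And>x y y'. x \<in> D \<Longrightarrow> y \<in> Y \<Longrightarrow> y' \<in> Y \<Longrightarrow> \<beta> x (y + y') = \<beta> x y + \<beta> x y'"
    and scale2: "\<And>c x y. x \<in> D \<Longrightarrow> y \<in> Y \<Longrightarrow> \<beta> x (cscale c y) = c * \<beta> x y"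
    and nondeg: "\<And>x. x \<in> D \<Longrightarrow> (\<And>y. y \<in> Y \<Longrightarrow> \<beta> x y = 0) \<Longrightarrow> x = 0"
  shows "card D * card {y \<in> Y. \<forall>x\<in>D. \<beta> x y = 0} = card Y"
proof -
  let ?q = "CARD('a)"
  have "{(y, x) \<in> Y \<times> D. \<beta> x y = 0} = prod.swap ` {(x, y) \<in> D \<times> Y. \<beta> x y = 0}" by auto
  then have eq: "card {(y, x) \<in> Y \<times> D. \<beta> x y = 0} = card {(x, y) \<in> D \<times> Y. \<beta> x y = 0}"
    by (simp add: card_image)
  have 0: "\<beta> 0 y = 0" if "y \<in> Y" for y
    using scale1[of 0 y 0] that fs.subspace_0[OF D(1)] by simp
  have "{x \<in> D. \<forall>y\<in>Y. \<beta> x y = 0} = {0}"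
    using nondeg 0 fs.subspace_0[OF D(1)] by blast
  then have "?q * card {(y, x) \<in> Y \<times> D. \<beta> x y = 0} = card Y * (card D + (?q - 1))"
    using double_count_zeros[OF Y D(2), of "\<lambda>y x. \<beta> x y"] add2 scale2 by simp
  moreover have "?q * card {(x, y) \<in> D \<times> Y. \<beta> x y = 0}
      = card D * (card Y + (?q - 1) * card {y \<in> Y. \<forall>x\<in>D. \<beta> x y = 0})"
    using double_count_zeros[OF D Y(2), of \<beta>] add1 scale1 by simp
  ultimately have "(?q - 1) * (card D * card {y \<in> Y. \<forall>x\<in>D. \<beta> x y = 0}) = (?q - 1) * card Y"
    unfolding eq by (simp add: algebra_simps)
  then show ?thesis using CARD_field_ge_2[where 'a='a] by simp
qed

section \<open>Alternating matrices and bivectors\<close>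

text \<open>Matrices are functions of a single pair so that \<open>cscale\<close> and the vector
  space \<open>fs\<close> apply to them. The zero diagonal is a separate condition because
  antisymmetry does not force it in characteristic 2.\<close>

definition alts :: "nat \<Rightarrow> (nat \<times> nat \<Rightarrow> 'a::field) set" where
  "alts m = {A. (\<forall>i j. A (i, j) + A (j, i) = 0) \<and> (\<forall>i. A (i, i) = 0) \<and> (\<forall>i j. m \<le> i \<longrightarrow> A (i, j) = 0)}"

definition wedge :: "(nat \<Rightarrow> 'a::field) \<Rightarrow> (nat \<Rightarrow> 'a) \<Rightarrow> nat \<times> nat \<Rightarrow> 'a" where
  "wedge u v = (\<lambda>(i, j). u i * v j - u j * v i)"

definition decs :: "nat \<Rightarrow> (nat \<times> nat \<Rightarrow> 'a::field) set" where
  "decs m = {A. A \<noteq> 0 \<and> (\<exists>u\<in>vecs m. \<exists>v\<in>vecs m. A = wedge u v)}"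

text \<open>\<open>D \<inter> wedges m u\<close> is the space D_u of the overview.\<close>

definition wedges :: "nat \<Rightarrow> (nat \<Rightarrow> 'a::field) \<Rightarrow> (nat \<times> nat \<Rightarrow> 'a) set" where
  "wedges m u = wedge u ` vecs m"

text \<open>The contraction A(x, -), written as the coordinate vector of a linear functional;
  \<open>ker\<close> is thus the radical of the form.\<close>

definition mul :: "nat \<Rightarrow> (nat \<times> nat \<Rightarrow> 'a::field) \<Rightarrow> (nat \<Rightarrow> 'a) \<Rightarrow> nat \<Rightarrow> 'a" where
  "mul m A x = (\<lambda>j. \<Sum>i<m. A (i, j) * x i)"

definition ker :: "nat \<Rightarrow> (nat \<times> nat \<Rightarrow> 'a::field) \<Rightarrow> (nat \<Rightarrow> 'a) set" where
  "ker m A = {x \<in> vecs m. mul m A x = 0}"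

definition dotp :: "nat \<Rightarrow> (nat \<Rightarrow> 'a::field) \<Rightarrow> (nat \<Rightarrow> 'a) \<Rightarrow> 'a" where
  "dotp m x y = (\<Sum>i<m. x i * y i)"

definition bil :: "nat \<Rightarrow> (nat \<times> nat \<Rightarrow> 'a::field) \<Rightarrow> (nat \<Rightarrow> 'a) \<Rightarrow> (nat \<Rightarrow> 'a) \<Rightarrow> 'a" where
  "bil m A x y = dotp m (mul m A x) y"

definition unitv :: "nat \<Rightarrow> nat \<Rightarrow> 'a::field" where
  "unitv i = (\<lambda>j. if j = i then 1 else 0)"

lemma subspace_vecs: "fs.subspace (vecs m)"
  by (rule fs.subspaceI) (auto simp: vecs_def cscale_def)

lemma vecs_bij_PiE: "bij_betw (\<lambda>x. restrict x {..<m}) (vecs m :: (nat \<Rightarrow> 'a::field) set) ({..<m} \<rightarrow>\<^sub>E UNIV)"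
  by (rule bij_betw_byWitness[where f' = "\<lambda>x i. if i < m then x i else 0"])
    (auto simp: vecs_def fun_eq_iff PiE_def extensional_def restrict_def)

lemma card_vecs: "card (vecs m :: (nat \<Rightarrow> 'a::{finite,field}) set) = CARD('a) ^ m"
  using bij_betw_same_card[OF vecs_bij_PiE[of m, where 'a='a]] by (simp add: card_PiE)

lemma finite_vecs: "finite (vecs m :: (nat \<Rightarrow> 'a::{finite,field}) set)"
  using bij_betw_finite[OF vecs_bij_PiE[of m, where 'a='a]] by (simp add: finite_PiE)

lemma unitv_vecs [simp]: "i < m \<Longrightarrow> unitv i \<in> vecs m"
  by (auto simp: unitv_def vecs_def)

lemma alts_swap: "A \<in> alts m \<Longrightarrow> A (j, i) = - A (i, j)"
  and alts_diag: "A \<in> alts m \<Longrightarrow> A (i, i) = 0"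
  and alts_outside: "A \<in> alts m \<Longrightarrow> m \<le> i \<or> m \<le> j \<Longrightarrow> A (i, j) = 0"
proof -
  show *: "A (j, i) = - A (i, j)" if "A \<in> alts m" for i j
    using that by (simp add: alts_def eq_neg_iff_add_eq_0)
  show "A \<in> alts m \<Longrightarrow> A (i, i) = 0" by (simp add: alts_def)
  show "A (i, j) = 0" if "A \<in> alts m" "m \<le> i \<or> m \<le> j"
    using that *[of i j] by (auto simp: alts_def)
qed

lemma subspace_alts: "fs.subspace (alts m)"
proof (rule fs.subspaceI)
  show "A + B \<in> alts m" if "A \<in> alts m" "B \<in> alts m" for A B :: "nat \<times> nat \<Rightarrow> 'a"
  proof -
    have *: "A (i, j) + B (i, j) + (A (j, i) + B (j, i)) = (A (i, j) + A (j, i)) + (B (i, j) + B (j, i))" for i j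
      by (simp add: algebra_simps)
    show ?thesis using that by (auto simp: alts_def *)
  qed
qed (auto simp: alts_def cscale_def simp flip: distrib_left)

abbreviation upper :: "nat \<Rightarrow> (nat \<times> nat) set" where
  "upper m \<equiv> (SIGMA i:{..<m}. {i<..<m})"

lemma card_upper: "card (upper m) = m choose 2"
proof -
  have "card (upper m) = (\<Sum>i<m. m - Suc i)" by (subst card_SigmaI) auto
  also have "\<dots> = (\<Sum>i<m. i)" by (rule sum.nat_diff_reindex)
  also have "\<dots> = m choose 2"
    by (simp add: gauss_sum_nat lessThan_Suc_atMost choose_two Sum_Ico_nat lessThan_atLeast0)
  finally show ?thesis .
qed

lemma alts_bij_PiE: "bij_betw (\<lambda>A. restrict A (upper m)) (alts m :: (nat \<times> nat \<Rightarrow> 'a::field) set) (upper m \<rightarrow>\<^sub>E UNIV)"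
proof (rule bij_betw_byWitness[where f' = "\<lambda>f (i, j). if (i, j) \<in> upper m then f (i, j)
     else if (j, i) \<in> upper m then - f (j, i) else 0"])
  show "\<forall>A\<in>alts m. (\<lambda>(i, j). if (i, j) \<in> upper m then restrict A (upper m) (i, j)
     else if (j, i) \<in> upper m then - restrict A (upper m) (j, i) else (0::'a)) = A"
    by (rule ballI, rule ext) (auto simp: alts_diag alts_outside not_less antisym_conv3 intro: alts_swap[symmetric])
qed (auto simp: alts_def fun_eq_iff PiE_def extensional_def restrict_def)

lemma card_alts: "card (alts m :: (nat \<times> nat \<Rightarrow> 'a::{finite,field}) set) = CARD('a) ^ (m choose 2)"
  using bij_betw_same_card[OF alts_bij_PiE[of m, where 'a='a]]
  by (simp add: card_PiE card_upper del: card_SigmaI)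

lemma finite_alts: "finite (alts m :: (nat \<times> nat \<Rightarrow> 'a::{finite,field}) set)"
  using bij_betw_finite[OF alts_bij_PiE[of m, where 'a='a]] by (simp add: finite_PiE)

lemma wedge_apply: "wedge u v (i, j) = u i * v j - u j * v i"
  by (simp add: wedge_def)

lemma wedge_alts: "u \<in> vecs m \<Longrightarrow> v \<in> vecs m \<Longrightarrow> wedge u v \<in> alts m"
  by (auto simp: alts_def vecs_def wedge_def)

lemma wedge_add_right: "wedge u (v + w) = wedge u v + wedge u w"
  and wedge_add_left: "wedge (v + w) u = wedge v u + wedge w u"
  and wedge_scale_right: "wedge u (cscale c v) = cscale c (wedge u v)"
  and wedge_scale_left: "wedge (cscale c u) v = cscale c (wedge u v)"
  and wedge_self: "wedge u u = 0"
  and wedge_zero_right: "wedge u 0 = 0"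
  and wedge_zero_left: "wedge 0 u = 0"
  and wedge_swap: "wedge v u = cscale (- 1) (wedge u v)"
  by (auto simp: wedge_def fun_eq_iff cscale_def algebra_simps)

lemma subspace_wedges: "fs.subspace (wedges m u)"
proof (rule fs.subspaceI)
  show "0 \<in> wedges m u" unfolding wedges_def
    by (rule image_eqI[of _ _ 0]) (auto simp: wedge_zero_right vecs_def)
  show "x + y \<in> wedges m u" if "x \<in> wedges m u" "y \<in> wedges m u" for x y
    using that fs.subspace_add[OF subspace_vecs[of m, where 'a='a]] unfolding wedges_def
    by (auto simp flip: wedge_add_right)
  show "cscale c x \<in> wedges m u" if "x \<in> wedges m u" for c x
    using that fs.subspace_scale[OF subspace_vecs[of m, where 'a='a]] unfolding wedges_def
    by (auto simp flip: wedge_scale_right)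
qed

lemma wedges_scale: "c \<noteq> 0 \<Longrightarrow> wedges m (cscale c u) = wedges m u"
proof -
  have *: "wedges m (cscale c u) \<subseteq> wedges m u" for c :: 'a and u
    using fs.subspace_scale[OF subspace_wedges[of m u]] unfolding wedges_def
    by (auto simp: wedge_scale_left)
  assume "c \<noteq> 0"
  then have "u = cscale (inverse c) (cscale c u)" by simp
  then show ?thesis using *[of c u] *[of "inverse c" "cscale c u"] by simp
qed

text \<open>Adding multiples of \<open>u\<close> to v does not change u wedge v, so every fibre of
  \<open>wedge u\<close> on V has at least q elements. This caps |D_u| at q^(m-1), the upper end of
  the range of a.\<close>

lemma card_wedges:
  fixes u :: "nat \<Rightarrow> 'a::{finite,field}"
  assumes u: "u \<in> vecs m" "u \<noteq> 0"
  shows "card (wedges m u) * CARD('a) \<le> CARD('a) ^ m"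
proof -
  define s where "s = inv_into (vecs m) (wedge u)"
  have s: "s A \<in> vecs m" "wedge u (s A) = A" if "A \<in> wedges m u" for A
    using that by (auto simp: s_def wedges_def inv_into_into f_inv_into_f)
  let ?h = "\<lambda>(A, c::'a). s A + cscale c u"
  have "inj_on ?h (wedges m u \<times> UNIV)"
  proof (rule inj_onI, clarify)
    fix A B and c d :: 'a
    assume A: "A \<in> wedges m u" and B: "B \<in> wedges m u" and eq: "s A + cscale c u = s B + cscale d u"
    have "wedge u (s A + cscale c u) = A" "wedge u (s B + cscale d u) = B"
      by (simp_all add: wedge_add_right wedge_scale_right wedge_self s A B)
    then have "A = B" using eq by simp
    then show "A = B \<and> c = d" using eq u(2) by simp
  qed
  then have "card (wedges m u \<times> (UNIV :: 'a set)) \<le> card (vecs m :: (nat \<Rightarrow> 'a) set)"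
    by (rule card_inj_on_le)
      (use s u subspace_vecs[of m, where 'a='a] finite_vecs in
        \<open>auto intro!: fs.subspace_add fs.subspace_scale\<close>)
  then show ?thesis by (simp add: card_cartesian_product card_vecs)
qed

section \<open>Alternating matrices as bilinear forms\<close>

lemma mul_wedge: "mul m (wedge u v) x = cscale (dotp m u x) v - cscale (dotp m v x) u"
  by (auto simp: mul_def wedge_def dotp_def fun_eq_iff cscale_def sum_distrib_left sum_distrib_right
      sum_subtractf[symmetric] algebra_simps intro!: sum.cong)

lemma dotp_add: "dotp m x (y + z) = dotp m x y + dotp m x z"
  and dotp_scale: "dotp m x (cscale c y) = c * dotp m x y"
  and dotp_add_left: "dotp m (x + x') y = dotp m x y + dotp m x' y"
  and dotp_scale_left: "dotp m (cscale c x) y = c * dotp m x y"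
  by (auto simp: dotp_def sum.distrib algebra_simps cscale_def sum_distrib_left intro!: sum.cong)

lemma dotp_unitv: "i < m \<Longrightarrow> dotp m x (unitv i) = x i"
  by (simp add: dotp_def unitv_def if_distrib cong: if_cong)

lemma mul_add: "mul m A (x + y) = mul m A x + mul m A y"
  and mul_scale: "mul m A (cscale c x) = cscale c (mul m A x)"
  and mul_add_left: "mul m (A + B) x = mul m A x + mul m B x"
  and mul_scale_left: "mul m (cscale c A) x = cscale c (mul m A x)"
  by (auto simp: mul_def sum.distrib algebra_simps cscale_def sum_distrib_left fun_eq_iff intro!: sum.cong)

lemma bil_add_right: "bil m A x (y + z) = bil m A x y + bil m A x z"
  and bil_scale_right: "bil m A x (cscale c y) = c * bil m A x y"
  and bil_add_mid: "bil m A (x + y) z = bil m A x z + bil m A y z"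
  and bil_scale_mid: "bil m A (cscale c x) y = c * bil m A x y"
  and bil_add_left: "bil m (A + B) x y = bil m A x y + bil m B x y"
  and bil_scale_left: "bil m (cscale c A) x y = c * bil m A x y"
  by (simp_all add: bil_def mul_add mul_scale mul_add_left mul_scale_left dotp_add dotp_scale
      dotp_add_left dotp_scale_left)

lemma vecs_eq_0_iff: "x \<in> vecs m \<Longrightarrow> (\<forall>i<m. x i = 0) \<longleftrightarrow> x = 0"
  by (auto simp: vecs_def fun_eq_iff) (metis not_le_imp_less)

lemma mul_vecs: "A \<in> alts m \<Longrightarrow> mul m A x \<in> vecs m"
  unfolding mul_def vecs_def by (auto intro!: sum.neutral simp: alts_outside)

lemma dotp_eq_0_all: "x \<in> vecs m \<Longrightarrow> (\<And>y. y \<in> vecs m \<Longrightarrow> dotp m x y = 0) \<Longrightarrow> x = 0"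
  by (metis dotp_unitv unitv_vecs vecs_eq_0_iff)

text \<open>The diagonal terms vanish and the (j, i) term merges with the (i, j) term. The right
  side has the shape used in \<open>grass_word\<close>, so evaluating a code word becomes evaluating
  a form.\<close>

lemma bil_sum_upper:
  assumes A: "A \<in> alts m"
  shows "bil m A x y = (\<Sum>i<m. \<Sum>j\<in>{i<..<m}. A (i, j) * (x i * y j - x j * y i))"
proof -
  have "bil m A x y = (\<Sum>j<m. \<Sum>i<m. A (i, j) * x i * y j)"
    by (simp add: bil_def mul_def dotp_def sum_distrib_right)
  also have "\<dots> = (\<Sum>i<m. \<Sum>j<m. A (i, j) * x i * y j)" by (rule sum.swap)
  also have "\<dots> = (\<Sum>i<m. \<Sum>j\<in>{i<..<m}. A (i, j) * x i * y j) + (\<Sum>i<m. \<Sum>j\<in>{..<i}. A (i, j) * x i * y j)"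
  proof -
    have "(\<Sum>j<m. A (i, j) * x i * y j)
        = (\<Sum>j\<in>{i<..<m}. A (i, j) * x i * y j) + (\<Sum>j\<in>{..<i}. A (i, j) * x i * y j)" if "i < m" for i
    proof -
      have "{..<m} = insert i ({i<..<m} \<union> {..<i})" using that by auto
      then have "(\<Sum>j<m. A (i, j) * x i * y j) = A (i, i) * x i * y i + (\<Sum>j\<in>{i<..<m} \<union> {..<i}. A (i, j) * x i * y j)"
        by simp
      also have "A (i, i) = 0" using A by (rule alts_diag)
      finally show ?thesis by (subst (asm) sum.union_disjoint) auto
    qed
    then show ?thesis by (simp add: sum.distrib)
  qed
  also have "(\<Sum>i<m. \<Sum>j\<in>{..<i}. A (i, j) * x i * y j) = (\<Sum>i<m. \<Sum>j\<in>{i<..<m}. A (j, i) * x j * y i)"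
    unfolding sum.Sigma[OF finite_lessThan ballI[OF finite_lessThan]] 
    by (subst sum.Sigma, simp, simp)
      (rule sum.reindex_bij_witness[where i = prod.swap and j = prod.swap], auto)
  also have "(\<Sum>i<m. \<Sum>j\<in>{i<..<m}. A (i, j) * x i * y j) + \<dots> = (\<Sum>i<m. \<Sum>j\<in>{i<..<m}. A (i, j) * (x i * y j - x j * y i))"
    unfolding sum.distrib[symmetric]
  proof (intro sum.cong refl)
    fix i j
    have "A (j, i) = - A (i, j)" using A by (rule alts_swap)
    then show "A (i, j) * x i * y j + A (j, i) * x j * y i = A (i, j) * (x i * y j - x j * y i)"
      by (simp add: algebra_simps)
  qed
  finally show ?thesis .
qed

lemma bil_self: "A \<in> alts m \<Longrightarrow> bil m A x x = 0"
  by (simp add: bil_sum_upper mult.commute)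

lemma bil_swap: "A \<in> alts m \<Longrightarrow> bil m A y x = - bil m A x y"
  by (simp add: bil_sum_upper right_diff_distrib sum_subtractf mult.commute)

section \<open>Kernels of alternating forms\<close>

lemma bil_unitv: "i < m \<Longrightarrow> j < m \<Longrightarrow> bil m A (unitv i) (unitv j) = A (i, j)"
  by (simp add: bil_def dotp_unitv) (simp add: mul_def unitv_def if_distrib cong: if_cong)

lemma alts_nonzeroE:
  assumes "A \<in> alts m" "A \<noteq> 0"
  obtains x y where "x \<in> vecs m" "y \<in> vecs m" "bil m A x y \<noteq> 0"
proof -
  obtain i j where ij: "A (i, j) \<noteq> 0" using assms(2) by (auto simp: fun_eq_iff)
  then have "i < m" "j < m" using alts_outside[OF assms(1)] by (meson not_le)+
  then show ?thesis using that[of "unitv i" "unitv j"] ij by (simp add: bil_unitv)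
qed

lemma bil_wedge: "bil m (wedge u v) z w = dotp m u z * dotp m v w - dotp m v z * dotp m u w"
proof -
  have "cscale a v - cscale b u = cscale a v + cscale (- b) u" for a b by simp
  then show ?thesis unfolding bil_def mul_wedge by (simp only: dotp_add_left dotp_scale_left) simp
qed

lemma ker_bil: "z \<in> ker m A \<Longrightarrow> bil m A z w = 0"
  by (simp add: ker_def bil_def dotp_def)

lemma ker_vecs: "ker m A \<subseteq> vecs m"
  by (auto simp: ker_def)

lemma finite_ker: "finite (ker m (A :: nat \<times> nat \<Rightarrow> 'a::{finite,field}))"
  using ker_vecs finite_vecs finite_subset by blast

lemma ker_0: "ker m 0 = vecs m"
  by (auto simp: ker_def mul_def fun_eq_iff)

text \<open>If A(x, y) is nonzero, the plane <x, y> meets the kernel only in 0: pairing z + a x + b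
  y with y and with x recovers a and b. So the product of kernel and plane injects into V.\<close>

lemma card_ker_nonzero:
  fixes A :: "nat \<times> nat \<Rightarrow> 'a::{finite,field}"
  assumes A: "A \<in> alts m" "A \<noteq> 0"
  shows "card (ker m A) * CARD('a) ^ 2 \<le> CARD('a) ^ m"
proof -
  obtain x y where xy: "x \<in> vecs m" "y \<in> vecs m" "bil m A x y \<noteq> 0" by (rule alts_nonzeroE[OF A])
  let ?h = "\<lambda>(z, a::'a, b::'a). z + cscale a x + cscale b y"
  have "inj_on ?h (ker m A \<times> UNIV)"
  proof (rule inj_onI, clarify)
    fix z a b z' a' b'
    assume z: "z \<in> ker m A" "z' \<in> ker m A"
      and eq: "z + cscale a x + cscale b y = z' + cscale a' x + cscale b' y"
    from eq have "bil m A (z + cscale a x + cscale b y) w = bil m A (z' + cscale a' x + cscale b' y) w" for w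
      by simp
    from this[of y] this[of x] have "a = a'" "b = b'"
      using xy(3) z bil_swap[OF A(1), of y x]
      by (simp_all add: bil_add_mid bil_scale_mid ker_bil bil_self[OF A(1)])
    then show "z = z' \<and> (a, b) = (a', b')" using eq by simp
  qed
  then have "card (ker m A \<times> (UNIV :: ('a \<times> 'a) set)) \<le> card (vecs m :: (nat \<Rightarrow> 'a) set)"
    by (rule card_inj_on_le)
      (use xy subspace_vecs[of m, where 'a='a] ker_vecs[of m A] finite_vecs in
        \<open>auto intro!: fs.subspace_add fs.subspace_scale\<close>)
  then show ?thesis by (simp add: card_cartesian_product card_vecs power2_eq_square)
qed

text \<open>A hyperbolic plane <x, y> is split off. The remaining form \<open>A'\<close> is nonzero
  because \<open>A\<close> is not decomposable, and a pair on which \<open>A'\<close> is nonzero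
  supplies two further directions independent of the kernel.\<close>

lemma card_ker_not_decs:
  fixes A :: "nat \<times> nat \<Rightarrow> 'a::{finite,field}"
  assumes A: "A \<in> alts m" "A \<noteq> 0" "A \<notin> decs m"
  shows "card (ker m A) * CARD('a) ^ 4 \<le> CARD('a) ^ m"
proof -
  obtain x y where xy: "x \<in> vecs m" "y \<in> vecs m" "bil m A x y \<noteq> 0" by (rule alts_nonzeroE[OF A(1,2)])
  define c where "c = inverse (bil m A x y)"
  have c: "c * bil m A x y = 1" using xy(3) by (simp add: c_def)
  \<comment> \<open>This is A - (Ax wedge Ay)/A(x, y). It kills x, y and the kernel of
    \<open>A\<close>, as \<open>x0\<close>, \<open>y0\<close> and \<open>z0\<close> verify.\<close>
  define A' where "A' = A + cscale (- c) (wedge (mul m A x) (mul m A y))"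
  have W: "wedge (mul m A x) (mul m A y) \<in> alts m" by (intro wedge_alts mul_vecs A)
  have A'1: "A' \<in> alts m" unfolding A'_def
    by (intro fs.subspace_add[OF subspace_alts] fs.subspace_scale[OF subspace_alts] W A)
  have "A' \<noteq> 0"
  proof
    assume "A' = 0"
    then have "A = wedge (cscale c (mul m A x)) (mul m A y)"
      by (simp add: A'_def wedge_scale_left)
    moreover have "cscale c (mul m A x) \<in> vecs m" "mul m A y \<in> vecs m"
      by (intro fs.subspace_scale[OF subspace_vecs] mul_vecs A)+
    ultimately show False using A by (auto simp: decs_def)
  qed
  then obtain x' y' where xy': "x' \<in> vecs m" "y' \<in> vecs m" "bil m A' x' y' \<noteq> 0"
    using alts_nonzeroE[OF A'1] by metis
  have A': "bil m A' z w = bil m A z w - c * (bil m A x z * bil m A y w - bil m A y z * bil m A x w)" for z w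
    by (simp only: A'_def bil_add_left bil_scale_left bil_wedge) (simp add: bil_def)
  note sw = bil_swap[OF A(1)] and sf = bil_self[OF A(1)]
  have x0: "bil m A' x w = 0" for w
  proof -
    have "bil m A' x w = bil m A x w - (c * bil m A x y) * bil m A x w"
      by (simp add: A' sf sw[of y x] algebra_simps)
    then show ?thesis using c by simp
  qed
  have y0: "bil m A' y w = 0" for w
  proof -
    have "bil m A' y w = bil m A y w - (c * bil m A x y) * bil m A y w"
      by (simp add: A' sf algebra_simps)
    then show ?thesis using c by simp
  qed
  have z0: "bil m A' z w = 0" if "z \<in> ker m A" for z w
    using that by (simp add: A' ker_bil sw[of x z] sw[of y z])
  let ?h = "\<lambda>(z, a::'a, b::'a, c::'a, d::'a). z + cscale a x + cscale b y + cscale c x' + cscale d y'"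
  have "inj_on ?h (ker m A \<times> UNIV)"
  proof (rule inj_onI, clarify)
    fix z a b e f z' a' b' e' f'
    assume z: "z \<in> ker m A" "z' \<in> ker m A"
      and eq: "z + cscale a x + cscale b y + cscale e x' + cscale f y'
         = z' + cscale a' x + cscale b' y + cscale e' x' + cscale f' y'"
    have *: "bil m B (z + cscale a x + cscale b y + cscale e x' + cscale f y') w
       = bil m B (z' + cscale a' x + cscale b' y + cscale e' x' + cscale f' y') w" for w B
      using eq by simp
    \<comment> \<open>\<open>A'\<close> does not see z, x and y, so it isolates the coefficients of
      x' and y'. Once those agree, \<open>A\<close> yields the other two.\<close>
    from *[of A' y'] *[of A' x'] have ef: "e = e'" "f = f'"
      using xy'(3) z bil_swap[OF A'1, of y' x']
      by (simp_all add: bil_add_mid bil_scale_mid z0 x0 y0 bil_self[OF A'1])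
    with *[of A y] *[of A x] have "a = a'" "b = b'"
      using xy(3) z bil_swap[OF A(1), of y x]
      by (simp_all add: bil_add_mid bil_scale_mid ker_bil bil_self[OF A(1)])
    then show "z = z' \<and> (a, b, e, f) = (a', b', e', f')" using eq ef by simp
  qed
  then have "card (ker m A \<times> (UNIV :: ('a \<times> 'a \<times> 'a \<times> 'a) set)) \<le> card (vecs m :: (nat \<Rightarrow> 'a) set)"
    by (rule card_inj_on_le)
      (use xy xy' subspace_vecs[of m, where 'a='a] ker_vecs[of m A] finite_vecs in
        \<open>auto intro!: fs.subspace_add fs.subspace_scale\<close>)
  then show ?thesis by (simp add: card_cartesian_product card_vecs power4_eq_xxxx mult.assoc)
qed

text \<open>Returning the subspace together with its size allows several linear conditions to be
  imposed in succession, each costing at most a factor q.\<close>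

lemma card_perp_ge:
  fixes S :: "(nat \<Rightarrow> 'a::{finite,field}) set"
  assumes "fs.subspace S"
  shows "card S \<le> CARD('a) * card {z \<in> S. dotp m u z = 0}"
    and "fs.subspace {z \<in> S. dotp m u z = 0}"
proof -
  show "card S \<le> CARD('a) * card {z \<in> S. dotp m u z = 0}"
    by (rule card_functional_kernel_le[OF assms]) (simp_all add: dotp_add dotp_scale)
  show "fs.subspace {z \<in> S. dotp m u z = 0}"
    using assms by (intro fs.subspaceI)
      (auto simp: dotp_add dotp_scale fs.subspace_0 fs.subspace_add fs.subspace_scale, simp add: dotp_def)
qed

lemma card_ker_wedge:
  fixes u :: "nat \<Rightarrow> 'a::{finite,field}"
  shows "CARD('a) ^ m \<le> CARD('a) ^ 2 * card (ker m (wedge u v))"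
proof -
  let ?S1 = "{z \<in> vecs m. dotp m u z = 0}" let ?S2 = "{z \<in> ?S1. dotp m v z = 0}"
  note s = card_perp_ge[OF subspace_vecs[of m, where 'a='a], of m u]
  have "CARD('a) ^ m \<le> CARD('a) * (CARD('a) * card ?S2)"
    using s(1) card_perp_ge(1)[OF s(2), of m v] unfolding card_vecs
    by (meson mult_le_mono2 order_trans)
  moreover have "card ?S2 \<le> card (ker m (wedge u v))"
    by (rule card_mono[OF finite_ker]) (auto simp: ker_def mul_wedge)
  ultimately show ?thesis
    by (metis (no_types, lifting) mult.assoc mult_le_mono2 order_trans power2_eq_square)
qed

text \<open>A vector orthogonal to u, v, w and x lies in the kernel, and these are four linear
  conditions. With \<open>card_ker_not_decs\<close> this determines the kernel size of a nonzero,
  non-decomposable sum.\<close>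

lemma card_ker_wedge_add:
  fixes u :: "nat \<Rightarrow> 'a::{finite,field}"
  shows "CARD('a) ^ m \<le> CARD('a) ^ 4 * card (ker m (wedge u v + wedge w x))"
proof -
  let ?S1 = "{z \<in> vecs m. dotp m u z = 0}" let ?S2 = "{z \<in> ?S1. dotp m v z = 0}"
  let ?S3 = "{z \<in> ?S2. dotp m w z = 0}" let ?S4 = "{z \<in> ?S3. dotp m x z = 0}"
  note s1 = card_perp_ge[OF subspace_vecs[of m, where 'a='a], of m u]
  note s2 = card_perp_ge[OF s1(2), of m v]
  note s3 = card_perp_ge[OF s2(2), of m w]
  note s4 = card_perp_ge[OF s3(2), of m x]
  have "CARD('a) ^ m \<le> CARD('a) * (CARD('a) * (CARD('a) * (CARD('a) * card ?S4)))"
    using s1(1) s2(1) s3(1) s4(1) unfolding card_vecs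
    by (meson mult_le_mono2 order_trans)
  moreover have "card ?S4 \<le> card (ker m (wedge u v + wedge w x))"
    by (rule card_mono[OF finite_ker]) (auto simp: ker_def mul_wedge mul_add_left)
  ultimately show ?thesis
    by (metis (no_types, lifting) mult.assoc mult_le_mono2 order_trans power4_eq_xxxx)
qed

text \<open>Otherwise u, v, w, x are independent, and the kernel of v wedge w + u wedge x lies in
  the space orthogonal to all four, of size q^(m-4). But a form y wedge z has a kernel of size at
  least q^(m-2).\<close>

lemma wedge_sum_decomposable:
  fixes u :: "nat \<Rightarrow> 'a::{finite,field}"
  assumes V: "u \<in> vecs m" "v \<in> vecs m" "w \<in> vecs m" "x \<in> vecs m" and u0: "u \<noteq> 0"
    and not: "wedge v w \<notin> wedges m u" and dec: "wedge v w + wedge u x = wedge y z"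
  obtains a b c where "x = cscale a u + cscale b v + cscale c w"
proof (rule ccontr)
  assume "\<not> thesis"
  then have notspan: "x \<noteq> cscale a u + cscale b v + cscale c w" for a b c using that by blast
  let ?f = "\<lambda>(a, b, c, d). cscale a u + cscale b v + cscale c w + cscale d x"
  \<comment> \<open>A relation with d nonzero puts x into <u, v, w>; one with b or c nonzero makes v
    wedge w divisible by u.\<close>
  have ind: "a = 0 \<and> b = 0 \<and> c = 0 \<and> d = 0"
    if eq: "cscale a u + cscale b v + cscale c w + cscale d x = 0" for a b c d
  proof -
    have d: "d = 0"
    proof (rule ccontr)
      assume "d \<noteq> 0"
      moreover have "cscale d x = cscale (-a) u + cscale (-b) v + cscale (-c) w"
        using eq by (simp add: add_eq_0_iff algebra_simps)
      ultimately have "x = cscale (inverse d) (cscale (-a) u + cscale (-b) v + cscale (-c) w)"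
        by (metis fs.scale_scale fs.scale_one left_inverse)
      then have "x = cscale (inverse d * -a) u + cscale (inverse d * -b) v + cscale (inverse d * -c) w"
        by (simp only: fs.scale_right_distrib fs.scale_scale)
      then show False using notspan by blast
    qed
    have b: "b = 0"
    proof (rule ccontr)
      assume "b \<noteq> 0"
      moreover have "cscale b v = cscale (-a) u + cscale (-c) w"
        using eq d by (simp add: add_eq_0_iff algebra_simps)
      ultimately have "v = cscale (inverse b) (cscale (-a) u + cscale (-c) w)"
        by (metis fs.scale_scale fs.scale_one left_inverse)
      then have "wedge v w = cscale (inverse b) (cscale (-a) (wedge u w) + cscale (-c) (wedge w w))"
        by (metis wedge_add_left wedge_scale_left)
      then have "wedge v w = wedge u (cscale (inverse b * -a) w)"
        by (simp only: wedge_self wedge_scale_right fs.scale_zero_right fs.scale_scale add_0_right)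
      then show False using not V(3) fs.subspace_scale[OF subspace_vecs] unfolding wedges_def by blast
    qed
    have c: "c = 0"
    proof (rule ccontr)
      assume "c \<noteq> 0"
      moreover have "cscale c w = cscale (-a) u"
        using eq d b by (simp add: add_eq_0_iff algebra_simps)
      ultimately have "w = cscale (inverse c) (cscale (-a) u)"
        by (metis fs.scale_scale fs.scale_one left_inverse)
      then have "wedge v w = wedge u (cscale (inverse c * a) v)"
        by (simp only: wedge_scale_right fs.scale_scale wedge_swap[of v u] mult_minus_right mult_1_right minus_minus)
      then show False using not V(2) fs.subspace_scale[OF subspace_vecs] unfolding wedges_def by blast
    qed
    show ?thesis using eq u0 b c d by simp
  qed
  define S where "S = range ?f"
  have "inj ?f"
  proof (rule injI, clarify)
    fix a b c d a' b' c' d'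
    assume "cscale a u + cscale b v + cscale c w + cscale d x = cscale a' u + cscale b' v + cscale c' w + cscale d' x"
    then have "cscale (a - a') u + cscale (b - b') v + cscale (c - c') w + cscale (d - d') x = 0"
      by (simp add: fs.scale_left_diff_distrib algebra_simps)
    from ind[OF this] show "a = a' \<and> (b, c, d) = (b', c', d')" by simp
  qed
  then have cardS: "card S = CARD('a) ^ 4"
    by (simp add: S_def card_image card_prod power4_eq_xxxx mult.assoc)
  have S: "fs.subspace S"
  proof (rule fs.subspaceI)
    show "0 \<in> S" unfolding S_def by (rule range_eqI[of _ _ "(0, 0, 0, 0)"]) simp
    show "r + s \<in> S" if rs: "r \<in> S" "s \<in> S" for r s
    proof -
      from rs obtain a b c d a' b' c' d' where "r = ?f (a, b, c, d)" "s = ?f (a', b', c', d')"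
        unfolding S_def by fastforce
      then have "r + s = ?f (a + a', b + b', c + c', d + d')"
        by (simp add: fs.scale_left_distrib algebra_simps)
      then show ?thesis unfolding S_def by (rule range_eqI)
    qed
    show "cscale k r \<in> S" if r: "r \<in> S" for k r
    proof -
      from r obtain a b c d where "r = ?f (a, b, c, d)" unfolding S_def by fastforce
      then have "cscale k r = ?f (k * a, k * b, k * c, k * d)" by (simp add: fs.scale_right_distrib)
      then show ?thesis unfolding S_def by (rule range_eqI)
    qed
  qed
  have SV: "S \<subseteq> vecs m"
    unfolding S_def using V subspace_vecs[of m, where 'a='a]
    by (auto intro!: fs.subspace_add fs.subspace_scale)
  let ?P = "{z \<in> vecs m. \<forall>s\<in>S. dotp m s z = 0}"
  have perp: "card S * card ?P = CARD('a) ^ m"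
    unfolding card_vecs[symmetric]
    by (rule card_annihilator[OF S finite_subset[OF SV finite_vecs] subspace_vecs finite_vecs])
      (use SV dotp_eq_0_all in \<open>auto simp: dotp_add dotp_scale dotp_add_left dotp_scale_left\<close>)
  have "ker m (wedge y z) \<subseteq> ?P"
  proof
    fix t assume t: "t \<in> ker m (wedge y z)"
    then have "mul m (wedge v w + wedge u x) t = 0" by (simp add: dec ker_def)
    \<comment> \<open>Contraction with t is a combination of the independent u, v, w, x, so t is
      orthogonal to each of them.\<close>
    then have "cscale (- dotp m x t) u + cscale (- dotp m w t) v + cscale (dotp m v t) w + cscale (dotp m u t) x = 0"
      by (simp add: mul_add_left mul_wedge algebra_simps)
    from ind[OF this] have "dotp m x t = 0" "dotp m w t = 0" "dotp m v t = 0" "dotp m u t = 0" by auto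
    then show "t \<in> ?P" using t by (auto simp: ker_def S_def dotp_add_left dotp_scale_left)
  qed
  then have "card (ker m (wedge y z)) \<le> card ?P" by (intro card_mono) (auto simp: finite_vecs)
  then have "card S * card (ker m (wedge y z)) \<le> card S * card ?P" by (rule mult_le_mono2)
  then have "CARD('a) ^ 4 * card (ker m (wedge y z)) \<le> CARD('a) ^ m"
    unfolding perp unfolding cardS .
  also have "\<dots> \<le> CARD('a) ^ 2 * card (ker m (wedge y z))" by (rule card_ker_wedge)
  finally have le: "CARD('a) ^ 4 * card (ker m (wedge y z)) \<le> CARD('a) ^ 2 * card (ker m (wedge y z))" .
  have "0 \<in> ker m (wedge y z)" by (auto simp: ker_def mul_def vecs_def fun_eq_iff)
  then have "card (ker m (wedge y z)) > 0" using finite_ker card_gt_0_iff by blast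
  with le have "CARD('a) ^ 4 \<le> CARD('a) ^ 2" by simp
  moreover have "CARD('a) ^ 2 < CARD('a) ^ 4" using CARD_field_ge_2[where 'a='a] by (intro power_strict_increasing) auto
  ultimately show False by simp
qed

section \<open>Decomposable elements of an m-dimensional space\<close>

text \<open>Relative to one member v wedge w, any other is v wedge w + u wedge x with x = a u + b v
  + c w by \<open>wedge_sum_decomposable\<close>. The term a u dies in u wedge x, which leaves q^2
  choices of (b, c). Cosets are taken modulo all of \<open>wedges m u\<close>, which contains
  D_u.\<close>

lemma card_decs_coset_le:
  fixes u :: "nat \<Rightarrow> 'a::{finite,field}"
  assumes u: "u \<in> vecs m" "u \<noteq> 0"
  shows "finite {g \<in> decs m - wedges m u. h - g \<in> wedges m u}"
    and "card {g \<in> decs m - wedges m u. h - g \<in> wedges m u} \<le> CARD('a) ^ 2"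
proof -
  let ?Q = "{g \<in> decs m - wedges m u. h - g \<in> wedges m u}"
  have "finite ?Q \<and> card ?Q \<le> CARD('a) ^ 2"
  proof (cases "?Q = {}")
    case False
    then obtain v w where vw: "wedge v w \<notin> wedges m u" "h - wedge v w \<in> wedges m u" "v \<in> vecs m" "w \<in> vecs m"
      unfolding decs_def by blast
    let ?h = "\<lambda>(b, c). wedge v w + wedge u (cscale b v + cscale c w)"
    have "?Q \<subseteq> range ?h"
    proof
      fix g assume g: "g \<in> ?Q"
      then obtain y z where gyz: "g = wedge y z" by (auto simp: decs_def)
      have "(h - wedge v w) - (h - g) \<in> wedges m u"
        using g vw fs.subspace_diff[OF subspace_wedges] by blast
      then have "g - wedge v w \<in> wedges m u" by simp
      then obtain x where x: "x \<in> vecs m" "g - wedge v w = wedge u x" unfolding wedges_def by blast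
      have gx: "wedge v w + wedge u x = g" using x(2) by (simp add: algebra_simps)
      obtain a b c where "x = cscale a u + cscale b v + cscale c w"
        using wedge_sum_decomposable[OF u(1) vw(3,4) x(1) u(2) vw(1)] gx gyz by metis
      then have "wedge u x = wedge u (cscale b v + cscale c w)"
        by (simp add: wedge_add_right wedge_scale_right wedge_self)
      then have "g = ?h (b, c)" using gx by simp
      then show "g \<in> range ?h" by (rule range_eqI)
    qed
    moreover have "card (range ?h) \<le> CARD('a \<times> 'a)" by (rule card_image_le) simp
    moreover have "finite (range ?h)" by simp
    ultimately show ?thesis
      using card_mono[of "range ?h" ?Q] finite_subset[of ?Q "range ?h"] by (simp add: power2_eq_square)
  qed (simp only: finite.emptyI card.empty zero_le simp_thms)
  then show "finite ?Q" "card ?Q \<le> CARD('a) ^ 2" by blast+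
qed

text \<open>Pairs (g, d) with g a decomposable outside D_u and d in D_u are sorted by h = g + d:
  each h leaves at most q^2 candidates for g. This averages over the cosets of D_u without choosing
  representatives.\<close>

lemma card_decs_pencil:
  fixes D :: "(nat \<times> nat \<Rightarrow> 'a::{finite,field}) set"
  assumes D: "fs.subspace D" "finite D" "card D = CARD('a) ^ m"
    and u: "u \<in> vecs m" "u \<noteq> 0"
    and a: "card (D \<inter> wedges m u) = CARD('a) ^ a" "3 \<le> a"
  shows "card (D \<inter> decs m) + CARD('a) ^ 2 + 1 \<le> CARD('a) ^ (m - 1) + CARD('a) ^ 3"
proof -
  let ?q = "CARD('a)"
  let ?U = "D \<inter> wedges m u" and ?T = "D \<inter> decs m - wedges m u"
  let ?F = "\<lambda>h. {g \<in> decs m - wedges m u. h - g \<in> wedges m u}"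
  note w = subspace_wedges[of m u]
  have q: "?q \<ge> 2" by (rule CARD_field_ge_2)
  have "inj_on (\<lambda>(g, d). (g + d, g)) (?T \<times> ?U)" by (auto simp: inj_on_def)
  moreover have "(\<lambda>(g, d). (g + d, g)) ` (?T \<times> ?U) \<subseteq> (SIGMA h:D - ?U. ?F h)"
  proof (rule image_subsetI, simp only: split_paired_all split_conv mem_Times_iff fst_conv snd_conv)
    fix g d assume "g \<in> ?T \<and> d \<in> ?U"
    then have *: "g \<in> D" "g \<in> decs m" "g \<notin> wedges m u" "d \<in> D" "d \<in> wedges m u" by auto
    have "g + d \<notin> wedges m u"
      using * fs.subspace_diff[OF w, of "g + d" d] by auto
    then show "(g + d, g) \<in> (SIGMA h:D - ?U. ?F h)"
      using * fs.subspace_add[OF D(1)] by simp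
  qed
  moreover have "finite (SIGMA h:D - ?U. ?F h)" using D(2) card_decs_coset_le(1)[OF u] by blast
  ultimately have "card (?T \<times> ?U) \<le> card (SIGMA h:D - ?U. ?F h)" by (rule card_inj_on_le)
  also have "\<dots> = (\<Sum>h\<in>D - ?U. card (?F h))" using D(2) card_decs_coset_le(1)[OF u] by (intro card_SigmaI) auto
  also have "\<dots> \<le> card (D - ?U) * ?q ^ 2"
    using sum_bounded_above[of "D - ?U" "\<lambda>h. card (?F h)" "?q ^ 2"] card_decs_coset_le(2)[OF u] by simp
  also have "card (D - ?U) = ?q ^ m - ?q ^ a"
    using D by (subst card_Diff_subset) (auto simp: a)
  finally have T: "card ?T * ?q ^ a \<le> (?q ^ m - ?q ^ a) * ?q ^ 2"
    by (simp add: card_cartesian_product a)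
  have fw: "finite (wedges m u)" unfolding wedges_def using finite_vecs by blast
  have "?q ^ a * ?q \<le> ?q ^ m"
    using card_wedges[OF u] card_mono[OF fw, of ?U] a(1)
    by (metis inf_le2 mult_le_mono1 order_trans)
  then have "a + 1 \<le> m"
    using q by (metis power_Suc2 power_increasing_iff Suc_eq_plus1 Suc_1 Suc_le_lessD)
  \<comment> \<open>\<open>s\<close> and \<open>t\<close> are the distances of a from its two ends 3
    and m - 1.\<close>
  then obtain s t where s: "a = 3 + s" and t: "m = a + 1 + t"
    using a(2) by (metis le_Suc_ex)
  have "?q ^ m - ?q ^ a = (?q ^ (t + 1) - 1) * ?q ^ a"
    by (simp add: t power_add diff_mult_distrib2 mult_ac)
  with T have "card ?T * ?q ^ a \<le> ((?q ^ (t + 1) - 1) * ?q ^ 2) * ?q ^ a"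
    by (simp only: mult_ac)
  then have T': "card ?T \<le> (?q ^ (t + 1) - 1) * ?q ^ 2" using q by simp
  have "D \<inter> decs m \<subseteq> ?T \<union> (?U - {0})" by (auto simp: decs_def)
  then have "card (D \<inter> decs m) \<le> card (?T \<union> (?U - {0}))" using D(2) by (intro card_mono) auto
  also have "\<dots> \<le> card ?T + card (?U - {0})" by (rule card_Un_le)
  also have "card (?U - {0}) = ?q ^ a - 1"
    using fs.subspace_0[OF w] fs.subspace_0[OF D(1)] D(2) a(1) by (subst card_Diff_singleton) auto
  finally have R: "card (D \<inter> decs m) \<le> (?q ^ (t + 1) - 1) * ?q ^ 2 + (?q ^ a - 1)" using T' by linarith
  have ge1: "?q ^ n \<ge> 1" for n using q by simp
  have "(?q ^ (t + 1) - 1) * ?q ^ 2 + ?q ^ 2 = ?q ^ 3 * ?q ^ t"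
    by (simp add: diff_mult_distrib power_add power2_eq_square power3_eq_cube)
  moreover have "?q ^ a = ?q ^ 3 * ?q ^ s" by (simp add: s power_add)
  \<comment> \<open>This is (q^s - 1) (q^t - 1) \<ge> 0. It is an equality for s = 0 and for t = 0,
    so both ends give the same bound.\<close>
  moreover have "?q ^ s + ?q ^ t \<le> ?q ^ s * ?q ^ t + 1"
  proof -
    obtain x y where xy: "?q ^ s = x + 1" "?q ^ t = y + 1" using ge1 by (metis le_add_diff_inverse2)
    show ?thesis unfolding xy by (simp add: algebra_simps)
  qed
  then have "?q ^ 3 * ?q ^ s + ?q ^ 3 * ?q ^ t \<le> ?q ^ 3 * (?q ^ s * ?q ^ t) + ?q ^ 3"
    by (metis add_mult_distrib2 mult_le_mono2 nat_mult_1_right)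
  moreover have "?q ^ (m - 1) = ?q ^ 3 * (?q ^ s * ?q ^ t)" by (simp add: t s power_add)
  ultimately show ?thesis using R ge1[of a] by linarith
qed

text \<open>Decomposables sharing no nonzero vector with f are thinned out by the translates g + c
  f: these are distinct for all (g, c) and avoid \<open>A\<close>, so there are at most (q^m -
  |A|)/q such g. The other decomposables lie in \<open>A\<close>, which is small by
  hypothesis.\<close>

lemma card_decs_no_pencil:
  fixes D :: "(nat \<times> nat \<Rightarrow> 'a::{finite,field}) set"
  assumes D: "fs.subspace D" "finite D" "card D = CARD('a) ^ m" and m: "m \<ge> 1"
    and small: "\<And>u. u \<in> vecs m \<Longrightarrow> u \<noteq> 0 \<Longrightarrow> card (D \<inter> wedges m u) \<le> CARD('a) ^ 2"
  shows "card (D \<inter> decs m) + CARD('a) ^ 2 + 1 \<le> CARD('a) ^ (m - 1) + CARD('a) ^ 3"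
proof (cases "D \<inter> decs m = {}")
  case True
  have q: "CARD('a) \<ge> 2" by (rule CARD_field_ge_2)
  have "CARD('a) ^ 2 \<le> CARD('a) ^ 3" using q by (intro power_increasing) auto
  moreover have "1 \<le> CARD('a) ^ (m - 1)" using q by simp
  ultimately show ?thesis unfolding True by (simp only: card.empty)
next
  case False
  let ?q = "CARD('a)"
  have q: "?q \<ge> 2" by (rule CARD_field_ge_2)
  obtain u v where uv: "wedge u v \<in> D" "u \<in> vecs m" "v \<in> vecs m" "wedge u v \<noteq> 0"
    using False by (auto simp: decs_def)
  define f where "f = wedge u v"
  have f: "f \<in> D" "f \<noteq> 0" using uv by (simp_all add: f_def)
  have v0: "v \<noteq> 0" using uv(4) by (auto simp: wedge_zero_right)
  have uc: "u + cscale c v \<noteq> 0" "u + cscale c v \<in> vecs m" for c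
  proof -
    show "u + cscale c v \<noteq> 0"
    proof
      assume "u + cscale c v = 0"
      then have "wedge (u + cscale c v) v = 0" by (simp add: wedge_zero_left)
      then show False using uv(4) by (simp add: wedge_add_left wedge_scale_left wedge_self)
    qed
    show "u + cscale c v \<in> vecs m"
      using uv fs.subspace_add[OF subspace_vecs] fs.subspace_scale[OF subspace_vecs] by blast
  qed
  \<comment> \<open>One representative for each of the q + 1 points of the projective line <u, v>.
    So \<open>A\<close> below consists of the elements of \<open>D\<close> divisible by some nonzero
    vector of <u, v>.\<close>
  let ?L = "insert v ((\<lambda>c. u + cscale c v) ` UNIV)"
  let ?W = "\<lambda>x. D \<inter> wedges m x"
  define A where "A = (\<Union>x\<in>?L. ?W x)"
  define F where "F = range (\<lambda>c. cscale c f)"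
  have L: "x \<in> vecs m" "x \<noteq> 0" if "x \<in> ?L" for x using that uc uv(3) v0 by auto
  have fw: "f \<in> wedges m x" if "x \<in> ?L" for x
  proof -
    have "f = wedge v (cscale (-1) u)" by (simp only: f_def wedge_swap[of u v] wedge_scale_right)
    moreover have "f = wedge (u + cscale c v) v" for c
      by (simp add: f_def wedge_add_left wedge_scale_left wedge_self)
    moreover have "cscale (-1) u \<in> vecs m" using uv fs.subspace_scale[OF subspace_vecs] by blast
    ultimately show ?thesis using that uv(3) unfolding wedges_def by blast
  qed
  have sub: "fs.subspace (?W x)" for x by (intro fs.subspace_inter D subspace_wedges)
  have F_sub: "F \<subseteq> ?W x" if "x \<in> ?L" for x
    using fs.subspace_scale[OF sub[of x], of f] fw[OF that] f(1) unfolding F_def by blast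
  have "inj (\<lambda>c. cscale c f)" using f(2) by (auto simp: inj_on_def)
  then have cardF: "card F = ?q" unfolding F_def by (rule card_image)
  have finA: "finite A" unfolding A_def using D(2) by auto
  have cardL: "card ?L \<le> ?q + 1"
    using card_insert_le_m1[of "?q + 1" "range (\<lambda>c. u + cscale c v)" v] card_image_le[of "UNIV :: 'a set" "\<lambda>c. u + cscale c v"]
    by simp
  \<comment> \<open>All the D_x contain the multiples \<open>F\<close> of f, which are therefore
    counted only once.\<close>
  have "A \<subseteq> F \<union> (\<Union>x\<in>?L. ?W x - F)" unfolding A_def by blast
  then have "card A \<le> card (F \<union> (\<Union>x\<in>?L. ?W x - F))"
    by (intro card_mono) (use D(2) in \<open>auto simp: F_def\<close>)
  also have "\<dots> \<le> card F + card (\<Union>x\<in>?L. ?W x - F)" by (rule card_Un_le)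
  also have "card (\<Union>x\<in>?L. ?W x - F) \<le> (\<Sum>x\<in>?L. card (?W x - F))" by (rule card_UN_le) simp
  also have "\<dots> \<le> card ?L * (?q ^ 2 - ?q)"
  proof -
    have "card (?W x - F) \<le> ?q ^ 2 - ?q" if "x \<in> ?L" for x
      using small[OF L[OF that]] F_sub[OF that] cardF
      by (subst card_Diff_subset) (auto simp: F_def)
    then show ?thesis using sum_bounded_above[of ?L "\<lambda>x. card (?W x - F)" "?q ^ 2 - ?q"] by simp
  qed
  also have "\<dots> \<le> (?q + 1) * (?q ^ 2 - ?q)" using cardL by (rule mult_le_mono1)
  finally have "card A \<le> ?q + (?q + 1) * (?q ^ 2 - ?q)" by (simp add: cardF)
  also have "\<dots> = ?q ^ 3"
  proof -
    obtain r where "?q = r + 1" using q by (metis le_add_diff_inverse2 one_le_numeral order_trans)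
    then show ?thesis by (simp add: power2_eq_square power3_eq_cube algebra_simps)
  qed
  finally have cardA: "card A \<le> ?q ^ 3" .
  define T where "T = D \<inter> decs m - A"
  \<comment> \<open>If g = y wedge z and g + c f is decomposable with c nonzero, then c v lies in
    <u, y, z>. So some c v - a u is a nonzero vector common to the planes of f and g, which puts g
    into \<open>A\<close>.\<close>
  have key: "c = 0" if g: "g \<in> T" and gc: "g + cscale c f \<in> decs m" for g c
  proof (rule ccontr)
    assume c: "c \<noteq> 0"
    from g obtain y z where yz: "g = wedge y z" "y \<in> vecs m" "z \<in> vecs m" unfolding T_def decs_def by blast
    have "u = u + cscale 0 v" by simp
    then have uL: "u \<in> ?L" by blast
    have u0: "u \<noteq> 0" using L(2)[OF uL] .
    have gu: "wedge y z \<notin> wedges m u" using g yz(1) uL unfolding T_def A_def by blast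
    have cv: "cscale c v \<in> vecs m" using uv(3) fs.subspace_scale[OF subspace_vecs] by blast
    have "wedge y z + wedge u (cscale c v) = g + cscale c f" by (simp add: yz f_def wedge_scale_right)
    moreover obtain y' z' where "g + cscale c f = wedge y' z'" using gc unfolding decs_def by blast
    ultimately have "wedge y z + wedge u (cscale c v) = wedge y' z'" by simp
    from wedge_sum_decomposable[OF uv(2) yz(2,3) cv u0 gu this]
    obtain a b d where abd: "cscale c v = cscale a u + cscale b y + cscale d z" .
    define x where "x = cscale b y + cscale d z"
    have x: "x = cscale c v + cscale (- a) u" using abd by (simp add: x_def algebra_simps)
    have x0: "x \<noteq> 0"
    proof
      assume "x = 0"
      then have "wedge u x = 0" by (simp add: wedge_zero_right)
      then have "cscale c f = 0" by (simp only: x wedge_add_right wedge_scale_right wedge_self f_def fs.scale_zero_right add_0_right)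
      then show False using c f(2) by simp
    qed
    have "g \<in> wedges m x"
    proof (cases "b = 0")
      case True
      then have d: "d \<noteq> 0" using x0 by (auto simp: x_def)
      have "wedge x (cscale (- inverse d) y) = cscale (- inverse d * d) (wedge z y)"
        using True by (simp only: x_def wedge_add_left wedge_scale_left wedge_scale_right fs.scale_scale
            fs.scale_zero_left add_0_left mult_zero_right)
      also have "\<dots> = cscale (-1) (wedge z y)" using d by simp
      also have "\<dots> = g" by (simp only: yz(1) wedge_swap[of y z])
      finally show ?thesis unfolding wedges_def
        using fs.subspace_scale[OF subspace_vecs yz(2)] by blast
    next
      case False
      have "wedge x (cscale (inverse b) z) = g"
        using False by (simp add: x_def wedge_add_left wedge_scale_left wedge_scale_right wedge_self yz(1))
      then show ?thesis unfolding wedges_def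
        using fs.subspace_scale[OF subspace_vecs yz(3)] by blast
    qed
    moreover have "\<exists>x'\<in>?L. \<exists>k. k \<noteq> 0 \<and> x = cscale k x'"
    proof (cases "a = 0")
      case True
      then have "x = cscale c v" by (simp add: x)
      then show ?thesis using c by blast
    next
      case False
      then have xe: "x = cscale (- a) (u + cscale (- (c / a)) v)"
        by (simp only: x fs.scale_right_distrib fs.scale_scale) (simp add: algebra_simps)
      have mem: "u + cscale (- (c / a)) v \<in> ?L" by blast
      show ?thesis
        by (rule bexI[OF _ mem], rule exI[of _ "- a"], rule conjI, simp add: False, rule xe)
    qed
    ultimately have "\<exists>x'\<in>?L. g \<in> wedges m x'" using wedges_scale by metis
    then show False using g unfolding T_def A_def by blast
  qed
  let ?h = "\<lambda>(g, c). g + cscale c f"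
  have "inj_on ?h (T \<times> UNIV)"
  proof (rule inj_onI, clarify)
    fix g c g' c' assume g: "g \<in> T" "g' \<in> T" and eq: "g + cscale c f = g' + cscale c' f"
    then have "g + cscale (c - c') f = g'" by (simp add: fs.scale_left_diff_distrib algebra_simps)
    moreover have "g' \<in> decs m" using g by (simp add: T_def)
    ultimately have "c - c' = 0" using key[OF g(1)] by metis
    then show "g = g' \<and> c = c'" using eq by simp
  qed
  moreover have "?h ` (T \<times> UNIV) \<subseteq> D - A"
  proof clarify
    fix g c assume g: "g \<in> T"
    then have "g \<in> D" by (simp add: T_def)
    moreover have cf: "cscale c f \<in> D" using f(1) D(1) fs.subspace_scale by blast
    \<comment> \<open>Each D_x is a subspace containing c f, so translation by c f cannot enter it
      from outside.\<close>
    moreover have "g + cscale c f \<notin> A"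
    proof
      assume "g + cscale c f \<in> A"
      then obtain x where x: "x \<in> ?L" "g + cscale c f \<in> ?W x" unfolding A_def by blast
      then have "g + cscale c f - cscale c f \<in> ?W x"
        using F_sub[OF x(1)] by (intro fs.subspace_diff[OF sub]) (auto simp: F_def)
      then show False using g x(1) unfolding T_def A_def by auto
    qed
    ultimately show "g + cscale c f \<in> D - A" using fs.subspace_add[OF D(1)] by blast
  qed
  moreover have "finite (D - A)" using D(2) by simp
  ultimately have "card (T \<times> (UNIV :: 'a set)) \<le> card (D - A)" by (rule card_inj_on_le)
  moreover have "A \<subseteq> D" unfolding A_def by blast
  ultimately have T: "card T * ?q + card A \<le> ?q ^ m"
    using D card_mono[OF D(2), of A] by (simp add: card_cartesian_product card_Diff_subset[OF finA] del: One_nat_def)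
  have "0 \<in> A" unfolding A_def using fs.subspace_0[OF sub[of v]] by blast
  then have A1: "card (A - {0}) + 1 = card A" using finA by (metis Suc_eq_plus1 card.remove)
  have "D \<inter> decs m \<subseteq> T \<union> (A - {0})" unfolding T_def decs_def by blast
  then have "card (D \<inter> decs m) \<le> card (T \<union> (A - {0}))"
    by (intro card_mono) (use finA D(2) in \<open>auto simp: T_def\<close>)
  also have "\<dots> \<le> card T + card (A - {0})" by (rule card_Un_le)
  finally have R: "card (D \<inter> decs m) + 1 \<le> card T + card A" using A1 by simp
  \<comment> \<open>For N decomposables, q (N + 1) \<le> q |T| + q |A|. The bound on q |T| + |A|
    absorbs one |A|; the remaining (q - 1) |A| uses |A| \<le> q^3.\<close>
  obtain r where r: "?q = r + 1" using q by (metis le_add_diff_inverse2 one_le_numeral order_trans)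
  have "(card (D \<inter> decs m) + 1) * ?q \<le> card T * ?q + card A + r * card A"
    using mult_le_mono1[OF R, of ?q] by (simp add: r algebra_simps)
  also have "\<dots> \<le> ?q ^ m + r * ?q ^ 3" using T cardA by (intro add_mono mult_le_mono2) auto
  also have "?q ^ m = ?q ^ (m - 1) * ?q" using m by (metis Suc_diff_1 Suc_le_eq One_nat_def power_Suc2)
  finally have "(card (D \<inter> decs m) + 1) * ?q + ?q ^ 3 \<le> ?q ^ (m - 1) * ?q + (r + 1) * ?q ^ 3" by simp
  then have "(card (D \<inter> decs m) + 1 + ?q ^ 2) * ?q \<le> (?q ^ (m - 1) + ?q ^ 3) * ?q"
    unfolding r[symmetric] by (simp add: algebra_simps power2_eq_square power3_eq_cube)
  then have "card (D \<inter> decs m) + 1 + ?q ^ 2 \<le> ?q ^ (m - 1) + ?q ^ 3"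
    by (rule mult_right_le_imp_le) (use q in simp)
  then show ?thesis by (simp add: ac_simps)
qed

lemma card_decs_le:
  fixes D :: "(nat \<times> nat \<Rightarrow> 'a::{finite,field}) set"
  assumes D: "fs.subspace D" "finite D" "card D = CARD('a) ^ m" and m: "m \<ge> 1"
  shows "card (D \<inter> decs m) + CARD('a) ^ 2 + 1 \<le> CARD('a) ^ (m - 1) + CARD('a) ^ 3"
proof (cases "\<exists>u\<in>vecs m. u \<noteq> 0 \<and> card (D \<inter> wedges m u) > CARD('a) ^ 2")
  case True
  then obtain u where u: "u \<in> vecs m" "u \<noteq> 0" "card (D \<inter> wedges m u) > CARD('a) ^ 2" by blast
  have "fs.subspace (D \<inter> wedges m u)" by (intro fs.subspace_inter D subspace_wedges)
  then obtain a where a: "card (D \<inter> wedges m u) = CARD('a) ^ a"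
    using subspace_card_power D(2) by (metis finite_Int)
  \<comment> \<open>|D_u| is a power of q, so exceeding q^2 means being at least q^3; the two cases
    leave no gap.\<close>
  have "2 < a" using u(3) CARD_field_ge_2[where 'a='a] unfolding a by (metis power_less_imp_less_exp Suc_1 Suc_le_lessD)
  then show ?thesis using card_decs_pencil[OF D u(1,2) a] by simp
next
  case False
  then show ?thesis using card_decs_no_pencil[OF D m] by (metis not_le)
qed

section \<open>Points of the Grassmannian\<close>

lemma span2_alt: "span2 u v = {cscale a u + cscale b v | a b. True}"
  by (simp add: span2_def cscale_def plus_fun_def)

lemma span2I: "cscale a u + cscale b v \<in> span2 u v"
  by (auto simp: span2_alt)

lemma subspace_span2: "fs.subspace (span2 u v)"
proof (rule fs.subspaceI)
  show "0 \<in> span2 u v" using span2I[of 0 u 0 v] by simp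
  show "x + y \<in> span2 u v" if xy: "x \<in> span2 u v" "y \<in> span2 u v" for x y
  proof -
    obtain a b a' b' where "x = cscale a u + cscale b v" "y = cscale a' u + cscale b' v"
      using xy unfolding span2_alt by blast
    then have "x + y = cscale (a + a') u + cscale (b + b') v"
      by (simp add: fs.scale_left_distrib algebra_simps)
    then show ?thesis using span2I by metis
  qed
  show "cscale c x \<in> span2 u v" if x: "x \<in> span2 u v" for c x
  proof -
    obtain a b where "x = cscale a u + cscale b v" using x unfolding span2_alt by blast
    then have "cscale c x = cscale (c * a) u + cscale (c * b) v"
      by (simp only: fs.scale_right_distrib fs.scale_scale)
    then show ?thesis using span2I by metis
  qed
qed

lemma span2_mem: "u \<in> span2 u v" "v \<in> span2 u v"
  using span2I[of 1 u 0 v] span2I[of 0 u 1 v] by simp_all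

lemma span2_subset: "fs.subspace S \<Longrightarrow> u \<in> S \<Longrightarrow> v \<in> S \<Longrightarrow> span2 u v \<subseteq> S"
  unfolding span2_alt by (auto intro!: fs.subspace_add fs.subspace_scale)

lemma wedge_eq_0D:
  assumes "wedge x y = 0" "x \<noteq> 0"
  obtains c where "y = cscale c x"
proof -
  obtain i where i: "x i \<noteq> 0" using assms(2) by (auto simp: fun_eq_iff)
  have "x i * y j = x j * y i" for j using fun_cong[OF assms(1), of "(i, j)"] by (simp add: wedge_apply)
  then have y: "y j = (y i / x i) * x j" for j using i by (simp add: field_simps)
  have "y = cscale (y i / x i) x" unfolding cscale_def by (rule ext) (rule y)
  then show ?thesis using that by blast
qed

lemma indep2_iff: "indep2 u v \<longleftrightarrow> wedge u v \<noteq> 0"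
proof
  assume ind: "indep2 u v"
  show "wedge u v \<noteq> 0"
  proof
    assume w: "wedge u v = 0"
    show False
    proof (cases "u = 0")
      case True
      then show False using ind unfolding indep2_def by (auto dest: spec[of _ 1] spec[of _ 0])
    next
      case False
      then obtain c where "v = cscale c u" by (rule wedge_eq_0D[OF w])
      then have "\<forall>i. c * u i + (- 1) * v i = 0" by (simp add: cscale_def)
      then have "(-1 :: 'a) = 0" using ind unfolding indep2_def by blast
      then show False by simp
    qed
  qed
next
  assume w: "wedge u v \<noteq> 0"
  show "indep2 u v" unfolding indep2_def
  proof (intro allI impI)
    fix a b assume "\<forall>i. a * u i + b * v i = 0"
    then have eq: "cscale a u + cscale b v = 0" by (auto simp: cscale_def)
    have "cscale a (wedge u v) = wedge (cscale a u + cscale b v) v"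
      by (simp add: wedge_add_left wedge_scale_left wedge_self)
    then have "cscale a (wedge u v) = 0" by (simp only: eq wedge_zero_left)
    moreover have "cscale b (wedge u v) = wedge u (cscale a u + cscale b v)"
      by (simp add: wedge_add_right wedge_scale_right wedge_self)
    then have "cscale b (wedge u v) = 0" by (simp only: eq wedge_zero_right)
    ultimately show "a = 0 \<and> b = 0" using w by simp
  qed
qed

lemma wedge_span2:
  assumes "x \<in> span2 u v" "y \<in> span2 u v"
  obtains c where "wedge x y = cscale c (wedge u v)"
proof -
  obtain a b a' b' where "x = cscale a u + cscale b v" "y = cscale a' u + cscale b' v"
    using assms unfolding span2_alt by blast
  then have "wedge x y = cscale (a * b' - a' * b) (wedge u v)"
    by (auto simp: wedge_def cscale_def fun_eq_iff algebra_simps)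
  then show ?thesis using that by blast
qed

text \<open>Row i of u wedge v is u_i v - v_i u, and as a row of c (u' wedge v') it lies in <u',
  v'>. If the entry d at (i, j) is nonzero, combinations of the rows i and j give back d u and d
  v.\<close>

lemma wedge_mem_span2:
  assumes eq: "wedge u v = cscale c (wedge u' v')" and nz: "wedge u v \<noteq> 0"
  shows "span2 u v \<subseteq> span2 u' v'"
proof -
  obtain i j where ij: "wedge u v (i, j) \<noteq> 0" using nz by (auto simp: fun_eq_iff)
  define d where "d = wedge u v (i, j)"
  have row: "(\<lambda>k. wedge u v (i, k)) \<in> span2 u' v'" for i
  proof -
    have "(\<lambda>k. wedge u v (i, k)) = cscale (- (c * v' i)) u' + cscale (c * u' i) v'"
      by (auto simp: eq cscale_def wedge_apply fun_eq_iff algebra_simps)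
    then show ?thesis using span2I by metis
  qed
  note s = fs.subspace_add[OF subspace_span2] fs.subspace_scale[OF subspace_span2]
  have "u = cscale (u j / d) (\<lambda>k. wedge u v (i, k)) + cscale (- (u i / d)) (\<lambda>k. wedge u v (j, k))"
  proof
    fix k
    have "d * u k = u j * wedge u v (i, k) - u i * wedge u v (j, k)"
      by (simp add: d_def wedge_apply algebra_simps)
    then show "u k = (cscale (u j / d) (\<lambda>k. wedge u v (i, k)) + cscale (- (u i / d)) (\<lambda>k. wedge u v (j, k))) k"
      using ij by (simp add: d_def[symmetric] cscale_def field_simps)
  qed
  then have u: "u \<in> span2 u' v'" using s row by metis
  have "v = cscale (v j / d) (\<lambda>k. wedge u v (i, k)) + cscale (- (v i / d)) (\<lambda>k. wedge u v (j, k))"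
  proof
    fix k
    have "d * v k = v j * wedge u v (i, k) - v i * wedge u v (j, k)"
      by (simp add: d_def wedge_apply algebra_simps)
    then show "v k = (cscale (v j / d) (\<lambda>k. wedge u v (i, k)) + cscale (- (v i / d)) (\<lambda>k. wedge u v (j, k))) k"
      using ij by (simp add: d_def[symmetric] cscale_def field_simps)
  qed
  then have "v \<in> span2 u' v'" using s row by metis
  with u show ?thesis by (intro span2_subset subspace_span2)
qed

lemma span2_eq_iff:
  assumes "wedge u v \<noteq> 0" "wedge u' v' \<noteq> 0"
  shows "span2 u v = span2 u' v' \<longleftrightarrow> (\<exists>c. c \<noteq> 0 \<and> wedge u v = cscale c (wedge u' v'))"
proof
  assume "span2 u v = span2 u' v'"
  then obtain c where "wedge u v = cscale c (wedge u' v')" using span2_mem wedge_span2 by metis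
  then show "\<exists>c. c \<noteq> 0 \<and> wedge u v = cscale c (wedge u' v')" using assms(1) by (metis fs.scale_zero_left)
next
  assume "\<exists>c. c \<noteq> 0 \<and> wedge u v = cscale c (wedge u' v')"
  then obtain c where c: "c \<noteq> 0" "wedge u v = cscale c (wedge u' v')" by blast
  then have "wedge u' v' = cscale (inverse c) (wedge u v)" by simp
  then show "span2 u v = span2 u' v'" using wedge_mem_span2 c assms by (metis subset_antisym)
qed

lemma span2_eqI:
  assumes "x \<in> span2 u v" "y \<in> span2 u v" "wedge x y \<noteq> 0"
  shows "span2 x y = span2 u v"
proof -
  obtain c where c: "wedge x y = cscale c (wedge u v)" by (rule wedge_span2[OF assms(1,2)])
  then have "wedge u v \<noteq> 0" "c \<noteq> 0" using assms(3) by (auto simp: fs.scale_zero_left)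
  then show ?thesis using span2_eq_iff c assms(3) by metis
qed

lemma Gr2_iff: "W \<in> Gr2 m \<longleftrightarrow> (\<exists>u\<in>vecs m. \<exists>v\<in>vecs m. wedge u v \<noteq> 0 \<and> W = span2 u v)"
  by (auto simp: Gr2_def indep2_iff)

lemma finite_Gr2: "finite (Gr2 m :: (nat \<Rightarrow> 'a::{finite,field}) set set)"
proof (rule finite_subset)
  show "Gr2 m \<subseteq> Pow (vecs m :: (nat \<Rightarrow> 'a) set)" using span2_subset[OF subspace_vecs[of m, where 'a='a]] by (fastforce simp: Gr2_iff)
qed (simp add: finite_vecs)

text \<open>Formed from the arbitrary basis that \<open>rep2\<close> picks. Only its line is
  canonical, so it is compared with other bivectors up to a nonzero scalar.\<close>

definition plucker :: "nat \<Rightarrow> (nat \<Rightarrow> 'a::field) set \<Rightarrow> nat \<times> nat \<Rightarrow> 'a" where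
  "plucker m W = wedge (fst (rep2 m W)) (snd (rep2 m W))"

lemma rep2:
  assumes "W \<in> Gr2 m"
  shows "fst (rep2 m W) \<in> vecs m" "snd (rep2 m W) \<in> vecs m" "plucker m W \<noteq> 0"
    "span2 (fst (rep2 m W)) (snd (rep2 m W)) = W"
proof -
  have "\<exists>p. fst p \<in> vecs m \<and> snd p \<in> vecs m \<and> indep2 (fst p) (snd p) \<and> W = span2 (fst p) (snd p)"
    using assms unfolding Gr2_def by auto
  from someI_ex[OF this]
  show "fst (rep2 m W) \<in> vecs m" "snd (rep2 m W) \<in> vecs m" "plucker m W \<noteq> 0"
    "span2 (fst (rep2 m W)) (snd (rep2 m W)) = W"
    unfolding rep2_def[symmetric] plucker_def by (auto simp: indep2_iff)
qed

lemma decs_alts: "decs m \<subseteq> alts m"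
  by (auto simp: decs_def wedge_alts)

lemma plucker_span2:
  assumes "u \<in> vecs m" "v \<in> vecs m" "wedge u v \<noteq> 0"
  obtains c where "c \<noteq> 0" "wedge u v = cscale c (plucker m (span2 u v))"
proof -
  have "span2 u v \<in> Gr2 m" using assms by (auto simp: Gr2_iff)
  note r = rep2[OF this]
  show ?thesis using span2_eq_iff[OF assms(3) r(3)[unfolded plucker_def]] r(4) that
    unfolding plucker_def by metis
qed

section \<open>Counting planes by their ordered bases\<close>

lemma card_wedge_pairs:
  fixes S :: "(nat \<Rightarrow> 'a::{finite,field}) set"
  assumes S: "fs.subspace S" "finite S"
  shows "card {(x, y) \<in> S \<times> S. wedge x y \<noteq> 0} = (card S - 1) * (card S - CARD('a))"
proof -
  have *: "wedge x y = 0 \<longleftrightarrow> y \<in> range (\<lambda>c. cscale c x)" if "x \<noteq> 0" for x y :: "nat \<Rightarrow> 'a"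
    using that by (auto simp: wedge_scale_right wedge_self elim: wedge_eq_0D)
  have "{(x, y) \<in> S \<times> S. wedge x y \<noteq> 0} = (SIGMA x:S - {0}. S - range (\<lambda>c. cscale c x))"
  proof (rule set_eqI)
    fix p :: "(nat \<Rightarrow> 'a) \<times> (nat \<Rightarrow> 'a)"
    obtain x y where p: "p = (x, y)" by (cases p)
    show "p \<in> {(x, y) \<in> S \<times> S. wedge x y \<noteq> 0} \<longleftrightarrow> p \<in> (SIGMA x:S - {0}. S - range (\<lambda>c. cscale c x))"
    proof (cases "x = 0")
      case True
      then show ?thesis by (simp add: p wedge_zero_left)
    next
      case False
      show ?thesis unfolding p using False *[OF False, of y] by blast
    qed
  qed
  then have "card {(x, y) \<in> S \<times> S. wedge x y \<noteq> 0} = (\<Sum>x\<in>S - {0}. card (S - range (\<lambda>c. cscale c x)))"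
    using S by simp
  also have "\<dots> = (\<Sum>x\<in>S - {0}. card S - CARD('a))"
  proof (rule sum.cong)
    fix x assume x: "x \<in> S - {0}"
    then have "inj (\<lambda>c. cscale c x)" by (auto simp: inj_on_def)
    then have "card (range (\<lambda>c. cscale c x)) = CARD('a)" by (rule card_image)
    moreover have "range (\<lambda>c. cscale c x) \<subseteq> S" using x S(1) fs.subspace_scale by blast
    ultimately show "card (S - range (\<lambda>c. cscale c x)) = card S - CARD('a)"
      by (subst card_Diff_subset) auto
  qed simp
  finally show ?thesis using fs.subspace_0[OF S(1)] S(2) by simp
qed

lemma card_span2:
  fixes u :: "nat \<Rightarrow> 'a::{finite,field}"
  assumes "wedge u v \<noteq> 0"
  shows "finite (span2 u v)" "card (span2 u v) = CARD('a) ^ 2"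
proof -
  let ?h = "\<lambda>(a, b). cscale a u + cscale b v"
  have s: "span2 u v = range ?h" by (auto simp: span2_alt)
  have "inj ?h"
  proof (rule injI, clarify)
    fix a b a' b' assume eq: "cscale a u + cscale b v = cscale a' u + cscale b' v"
    have "wedge (cscale a u + cscale b v) v = wedge (cscale a' u + cscale b' v) v"
      "wedge u (cscale a u + cscale b v) = wedge u (cscale a' u + cscale b' v)" using eq by simp_all
    then show "a = a' \<and> b = b'" using assms
      by (simp add: wedge_add_left wedge_scale_left wedge_add_right wedge_scale_right wedge_self)
  qed
  then show "card (span2 u v) = CARD('a) ^ 2" unfolding s by (simp add: card_image card_prod power2_eq_square)
  show "finite (span2 u v)" unfolding s by simp
qed

text \<open>A plane has (q^2 - 1) (q^2 - q) ordered bases, and an independent pair spans just one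
  plane. The family is arbitrary because both the whole Grassmannian and the support of a subcode
  are counted this way.\<close>

lemma card_pairs_spanning:
  fixes \<W> :: "(nat \<Rightarrow> 'a::{finite,field}) set set"
  assumes \<W>: "\<W> \<subseteq> Gr2 m"
  shows "card {(x, y) \<in> vecs m \<times> vecs m. wedge x y \<noteq> 0 \<and> span2 x y \<in> \<W>}
    = card \<W> * ((CARD('a) ^ 2 - 1) * (CARD('a) ^ 2 - CARD('a)))"
proof -
  let ?B = "\<lambda>W. {(x, y) \<in> W \<times> W. wedge x y \<noteq> 0}"
  have fin: "finite \<W>" using \<W> finite_Gr2 finite_subset by blast
  have W: "finite W" "card (?B W) = (CARD('a) ^ 2 - 1) * (CARD('a) ^ 2 - CARD('a))"
     "W \<subseteq> vecs m" "\<And>x y. x \<in> W \<Longrightarrow> y \<in> W \<Longrightarrow> wedge x y \<noteq> 0 \<Longrightarrow> span2 x y = W" if "W \<in> \<W>" for W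
  proof -
    have "W \<in> Gr2 m" using that \<W> by blast
    then obtain u v where uv: "u \<in> vecs m" "v \<in> vecs m" "wedge u v \<noteq> 0" "W = span2 u v"
      unfolding Gr2_iff by blast
    show "finite W" using card_span2[OF uv(3)] uv(4) by simp
    show "card (?B W) = (CARD('a) ^ 2 - 1) * (CARD('a) ^ 2 - CARD('a))"
      using card_span2[OF uv(3)] card_wedge_pairs[OF subspace_span2, of u v] uv(4) by simp
    show "W \<subseteq> vecs m" using span2_subset[OF subspace_vecs uv(1,2)] uv(4) by simp
    show "span2 x y = W" if "x \<in> W" "y \<in> W" "wedge x y \<noteq> 0" for x y
      using that span2_eqI uv(4) by metis
  qed
  have "{(x, y) \<in> vecs m \<times> vecs m. wedge x y \<noteq> 0 \<and> span2 x y \<in> \<W>} = (\<Union>W\<in>\<W>. ?B W)"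
  proof (intro equalityI subsetI)
    fix p assume "p \<in> {(x, y) \<in> vecs m \<times> vecs m. wedge x y \<noteq> 0 \<and> span2 x y \<in> \<W>}"
    then show "p \<in> (\<Union>W\<in>\<W>. ?B W)" using span2_mem by (cases p) fastforce
  next
    fix p assume "p \<in> (\<Union>W\<in>\<W>. ?B W)"
    then obtain W x y where *: "W \<in> \<W>" "p = (x, y)" "x \<in> W" "y \<in> W" "wedge x y \<noteq> 0" by blast
    then show "p \<in> {(x, y) \<in> vecs m \<times> vecs m. wedge x y \<noteq> 0 \<and> span2 x y \<in> \<W>}"
      using W(3)[OF *(1)] W(4)[OF *(1,3,4,5)] by auto
  qed
  also have "card \<dots> = (\<Sum>W\<in>\<W>. card (?B W))"
  proof (rule card_UN_disjoint[OF fin])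
    show "\<forall>W\<in>\<W>. finite (?B W)"
    proof
      fix W assume "W \<in> \<W>"
      then have "finite (W \<times> W)" using W(1) by simp
      then show "finite (?B W)" by (rule rev_finite_subset) auto
    qed
    show "\<forall>W\<in>\<W>. \<forall>W'\<in>\<W>. W \<noteq> W' \<longrightarrow> ?B W \<inter> ?B W' = {}"
    proof (intro ballI impI equals0I)
      fix W W' p assume *: "W \<in> \<W>" "W' \<in> \<W>" "W \<noteq> W'" "p \<in> ?B W \<inter> ?B W'"
      obtain x y where p: "p = (x, y)" by (cases p)
      have "x \<in> W" "y \<in> W" "x \<in> W'" "y \<in> W'" "wedge x y \<noteq> 0" using *(4) p by auto
      then have "span2 x y = W" "span2 x y = W'" using W(4)[OF *(1)] W(4)[OF *(2)] by blast+
      then show False using *(3) by simp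
    qed
  qed
  also have "\<dots> = card \<W> * ((CARD('a) ^ 2 - 1) * (CARD('a) ^ 2 - CARD('a)))" using W(2) by simp
  finally show ?thesis .
qed

lemma card_Gr2: "card (Gr2 m :: (nat \<Rightarrow> 'a::{finite,field}) set set) = gauss_binom CARD('a) m 2"
proof -
  let ?q = "CARD('a)"
  have "{(x, y) \<in> vecs m \<times> vecs m. wedge x y \<noteq> 0 \<and> span2 x y \<in> (Gr2 m :: (nat \<Rightarrow> 'a) set set)}
      = {(x, y) \<in> vecs m \<times> vecs m. wedge x y \<noteq> 0}"
    by (auto simp: Gr2_iff)
  then have eq: "card (Gr2 m :: (nat \<Rightarrow> 'a) set set) * ((?q ^ 2 - 1) * (?q ^ 2 - ?q)) = (?q ^ m - 1) * (?q ^ m - ?q)"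
    using card_pairs_spanning[OF order_refl, of m, where 'a='a]
      card_wedge_pairs[OF subspace_vecs finite_vecs, of m, where 'a='a] by (simp add: card_vecs)
  have "?q ^ 1 < ?q ^ 2" "?q ^ 0 < ?q ^ 2"
    by (rule power_strict_increasing; use CARD_field_ge_2[where 'a='a] in simp)+
  then have "(?q ^ 2 - 1) * (?q ^ 2 - ?q) > 0" by simp
  moreover have "gauss_binom ?q m 2 = ((?q ^ m - 1) * (?q ^ m - ?q)) div ((?q ^ 2 - 1) * (?q ^ 2 - ?q))"
    by (simp add: gauss_binom_def numeral_2_eq_2)
  \<comment> \<open>The product formula \<open>eq\<close> shows that the \<open>div\<close> in
    \<open>gauss_binom\<close> is exact.\<close>
  ultimately show ?thesis unfolding eq[symmetric] by simp
qed

section \<open>Code words as alternating forms\<close>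

text \<open>The sum runs over i < j because the sum over all pairs would count every term twice and
  vanish in characteristic 2.\<close>

definition pair :: "nat \<Rightarrow> (nat \<times> nat \<Rightarrow> 'a::field) \<Rightarrow> (nat \<times> nat \<Rightarrow> 'a) \<Rightarrow> 'a" where
  "pair m A B = (\<Sum>i<m. \<Sum>j\<in>{i<..<m}. A (i, j) * B (i, j))"

definition zeros :: "nat \<Rightarrow> (nat \<times> nat \<Rightarrow> 'a::field) set \<Rightarrow> (nat \<Rightarrow> 'a) set set" where
  "zeros m D = {W \<in> Gr2 m. \<forall>A\<in>D. pair m A (plucker m W) = 0}"

definition word :: "nat \<Rightarrow> (nat \<times> nat \<Rightarrow> 'a::field) \<Rightarrow> (nat \<Rightarrow> 'a) set \<Rightarrow> 'a" where
  "word m A = grass_word m (\<lambda>i j. A (i, j))"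

lemma pair_add: "pair m A (B + C) = pair m A B + pair m A C"
  and pair_scale: "pair m A (cscale c B) = c * pair m A B"
  and pair_add_left: "pair m (A + B) C = pair m A C + pair m B C"
  and pair_scale_left: "pair m (cscale c A) B = c * pair m A B"
  by (simp_all add: pair_def sum.distrib algebra_simps cscale_def sum_distrib_left)

lemma pair_commute: "pair m A B = pair m B A"
  by (simp add: pair_def mult.commute)

definition orth :: "nat \<Rightarrow> (nat \<times> nat \<Rightarrow> 'a::field) set \<Rightarrow> (nat \<times> nat \<Rightarrow> 'a) set" where
  "orth m D = {B \<in> alts m. \<forall>A\<in>D. pair m A B = 0}"

lemma orth_alts: "orth m D \<subseteq> alts m"
  by (auto simp: orth_def)

lemma subspace_orth: "fs.subspace (orth m D)"
  by (rule fs.subspaceI)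
    (auto simp: orth_def pair_add pair_scale fs.subspace_0[OF subspace_alts]
      fs.subspace_add[OF subspace_alts] fs.subspace_scale[OF subspace_alts], simp add: pair_def)

lemma pair_wedge: "A \<in> alts m \<Longrightarrow> pair m A (wedge x y) = bil m A x y"
  by (simp add: bil_sum_upper pair_def wedge_apply)

lemma pair_eq_0_all:
  assumes A: "A \<in> alts m" and 0: "\<And>B. B \<in> alts m \<Longrightarrow> pair m A B = 0"
  shows "A = 0"
proof (rule ccontr)
  assume "A \<noteq> 0"
  then obtain x y where "x \<in> vecs m" "y \<in> vecs m" "bil m A x y \<noteq> 0" using alts_nonzeroE[OF A] by metis
  then show False using 0[of "wedge x y"] pair_wedge[OF A] wedge_alts by metis
qed

lemma word_eq: "word m A W = (if W \<in> Gr2 m then pair m A (plucker m W) else 0)"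
  by (simp add: word_def grass_word_def pair_def plucker_def wedge_apply Let_def split: prod.split)

lemma word_add: "word m (A + B) = word m A + word m B"
  and word_scale: "word m (cscale c A) = cscale c (word m A)"
  by (auto simp: fun_eq_iff word_eq pair_add_left pair_scale_left cscale_def[of c "word m A"])

lemma pair_plucker_eq_0_iff:
  assumes "x \<in> vecs m" "y \<in> vecs m" "wedge x y \<noteq> 0"
  shows "pair m A (plucker m (span2 x y)) = 0 \<longleftrightarrow> pair m A (wedge x y) = 0"
proof -
  obtain c where "c \<noteq> 0" "wedge x y = cscale c (plucker m (span2 x y))" by (rule plucker_span2[OF assms])
  then show ?thesis by (simp add: pair_scale)
qed

lemma word_eq_0D:
  assumes A: "A \<in> alts m" and 0: "word m A = 0"
  shows "A = 0"
proof (rule ccontr)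
  assume "A \<noteq> 0"
  then obtain x y where xy: "x \<in> vecs m" "y \<in> vecs m" "bil m A x y \<noteq> 0" using alts_nonzeroE[OF A] by metis
  then have nz: "wedge x y \<noteq> 0" using pair_wedge[OF A, of x y] by (auto simp: pair_def)
  then have "span2 x y \<in> Gr2 m" using xy Gr2_iff by blast
  moreover have "word m A (span2 x y) = 0" using 0 by simp
  ultimately have "bil m A x y = 0"
    using pair_plucker_eq_0_iff[OF xy(1,2) nz, of A] by (simp add: word_eq pair_wedge[OF A])
  then show False using xy(3) by simp
qed

lemma inj_word: "inj_on (word m) (alts m)"
proof (rule inj_onI)
  fix A B assume A: "A \<in> alts m" and B: "B \<in> alts m" and eq: "word m A = word m B"
  have "word m (A + cscale (-1) B) = word m A + cscale (-1) (word m B)" by (simp only: word_add word_scale)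
  also have "\<dots> = 0" by (simp add: eq)
  finally have "word m (A + cscale (-1) B) = 0" .
  then have "A + cscale (-1) B = 0"
    by (rule word_eq_0D[rotated]) (intro fs.subspace_add[OF subspace_alts] fs.subspace_scale[OF subspace_alts] A B)
  then show "A = B" by simp
qed

section \<open>From subcodes to spaces of forms\<close>

lemma grass_code2_eq: "grass_code2 m = word m ` alts m"
proof (intro equalityI subsetI)
  fix w assume "w \<in> grass_code2 m"
  then obtain a where a: "w = grass_word m a" by (auto simp: grass_code2_def)
  \<comment> \<open>\<open>grass_word\<close> reads only the entries with i < j < m, so they can be
    extended antisymmetrically.\<close>
  define A where "A = (\<lambda>(i, j). if i < j \<and> j < m then a i j else if j < i \<and> i < m then - a j i else 0)"
  have "A \<in> alts m" by (auto simp: alts_def A_def)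
  moreover have "w = word m A" unfolding a word_def grass_word_def A_def by (auto intro!: ext sum.cong split: prod.split)
  ultimately show "w \<in> word m ` alts m" by blast
qed (auto simp: grass_code2_def word_def)

lemma supp_word: "supp_set (word m ` D) = Gr2 m - zeros m D"
  by (auto simp: supp_set_def zeros_def word_eq split: if_splits)

lemma subspace_image_word:
  assumes "fs.subspace D"
  shows "fs.subspace (word m ` D)"
proof (rule fs.subspaceI)
  have "word m (0 :: nat \<times> nat \<Rightarrow> 'a) = 0" by (auto simp: fun_eq_iff word_eq pair_def)
  then show "0 \<in> word m ` D" using fs.subspace_0[OF assms] by (metis imageI)
  show "x + y \<in> word m ` D" if "x \<in> word m ` D" "y \<in> word m ` D" for x y
    using that fs.subspace_add[OF assms] by (auto simp flip: word_add)
  show "cscale c x \<in> word m ` D" if "x \<in> word m ` D" for c x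
    using that fs.subspace_scale[OF assms] by (auto simp flip: word_scale)
qed

text \<open>\<open>word m\<close> is injective on \<open>alts m\<close>, so subcodes and spaces of
  forms of the same dimension correspond. Minimal support becomes maximal \<open>zeros m D\<close>;
  the subtraction is exact because \<open>zeros m D\<close> lies in \<open>Gr2 m\<close>.\<close>

lemma subcodes_eq:
  "{card (supp_set D) | D. D \<subseteq> (grass_code2 m :: ((nat \<Rightarrow> 'a::{finite,field}) set \<Rightarrow> 'a) set) \<and> is_subspace_dim D r}
   = {card (Gr2 m :: (nat \<Rightarrow> 'a) set set) - card (zeros m D) | D :: (nat \<times> nat \<Rightarrow> 'a) set.
        D \<subseteq> alts m \<and> fs.subspace D \<and> card D = CARD('a) ^ r}" (is "?L = ?R")
proof (intro equalityI subsetI)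
  have card: "card (supp_set (word m ` D)) = card (Gr2 m :: (nat \<Rightarrow> 'a) set set) - card (zeros m D)" for D :: "(nat \<times> nat \<Rightarrow> 'a) set"
    unfolding supp_word by (rule card_Diff_subset) (auto simp: zeros_def finite_Gr2)
  fix x
  {
    assume "x \<in> ?L"
    then obtain D where D: "x = card (supp_set D)" "D \<subseteq> (grass_code2 m :: ((nat \<Rightarrow> 'a) set \<Rightarrow> 'a) set)" "is_subspace_dim D r"
      by blast
    define E where "E = {A \<in> alts m. word m A \<in> D}"
    have DE: "D = word m ` E" using D(2) by (auto simp: E_def grass_code2_eq)
    have D': "fs.subspace D" "card D = CARD('a) ^ r" using D(3) by (auto simp: is_subspace_dim_iff)
    have "word m (0 :: nat \<times> nat \<Rightarrow> 'a) = 0" by (auto simp: fun_eq_iff word_eq pair_def)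
    then have "fs.subspace E"
      by (intro fs.subspaceI) (auto simp: E_def word_add word_scale fs.subspace_0[OF D'(1)]
        fs.subspace_0[OF subspace_alts] fs.subspace_add[OF D'(1)]
        fs.subspace_add[OF subspace_alts] fs.subspace_scale[OF D'(1)] fs.subspace_scale[OF subspace_alts])
    moreover have "card D = card E"
      unfolding DE by (rule card_image) (rule inj_on_subset[OF inj_word[of m]], auto simp: E_def)
    ultimately show "x \<in> ?R" using D(1) D'(2) card[of E] unfolding DE by (auto simp: E_def)
  }
  {
    assume "x \<in> ?R"
    then obtain D :: "(nat \<times> nat \<Rightarrow> 'a) set" where D: "x = card (Gr2 m :: (nat \<Rightarrow> 'a) set set) - card (zeros m D)" "D \<subseteq> alts m"
       "fs.subspace D" "card D = CARD('a) ^ r" by blast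
    have "card (word m ` D) = CARD('a) ^ r" using D(4) card_image[OF inj_on_subset[OF inj_word D(2)]] by simp
    then have "is_subspace_dim (word m ` D) r"
      using subspace_image_word[OF D(3)] D(2) finite_alts finite_subset by (simp add: is_subspace_dim_iff) blast
    moreover have "word m ` D \<subseteq> grass_code2 m" using D(2) by (auto simp: grass_code2_eq)
    moreover have "x = card (supp_set (word m ` D))" using card[of D] D(1) by simp
    ultimately show "x \<in> ?L" by blast
  }
qed

lemma higher_weight_eqI:
  fixes D :: "(nat \<times> nat \<Rightarrow> 'a::{finite,field}) set"
  assumes D: "D \<subseteq> alts m" "fs.subspace D" "card D = CARD('a) ^ r" "card (zeros m D) \<ge> z"
    and max: "\<And>D :: (nat \<times> nat \<Rightarrow> 'a) set. D \<subseteq> alts m \<Longrightarrow> fs.subspace D \<Longrightarrow> card D = CARD('a) ^ r \<Longrightarrow> card (zeros m D) \<le> z"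
  shows "higher_weight (grass_code2 m :: ((nat \<Rightarrow> 'a) set \<Rightarrow> 'a) set) r = card (Gr2 m :: (nat \<Rightarrow> 'a) set set) - z"
    and "z \<le> card (Gr2 m :: (nat \<Rightarrow> 'a) set set)"
proof -
  have z: "card (zeros m D) = z" using D max by (simp add: le_antisym)
  show "higher_weight (grass_code2 m :: ((nat \<Rightarrow> 'a) set \<Rightarrow> 'a) set) r = card (Gr2 m :: (nat \<Rightarrow> 'a) set set) - z"
    unfolding higher_weight_def subcodes_eq
  proof (rule cInf_eq_minimum)
    show "card (Gr2 m :: (nat \<Rightarrow> 'a) set set) - z \<in> {card (Gr2 m :: (nat \<Rightarrow> 'a) set set) - card (zeros m D) | D :: (nat \<times> nat \<Rightarrow> 'a) set.
        D \<subseteq> alts m \<and> fs.subspace D \<and> card D = CARD('a) ^ r}"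
      using D z by blast
    fix x assume "x \<in> {card (Gr2 m :: (nat \<Rightarrow> 'a) set set) - card (zeros m D) | D :: (nat \<times> nat \<Rightarrow> 'a) set.
        D \<subseteq> alts m \<and> fs.subspace D \<and> card D = CARD('a) ^ r}"
    then show "card (Gr2 m :: (nat \<Rightarrow> 'a) set set) - z \<le> x" using max by (auto intro: diff_le_mono2)
  qed
  show "z \<le> card (Gr2 m :: (nat \<Rightarrow> 'a) set set)"
    unfolding z[symmetric] by (rule card_mono[OF finite_Gr2]) (auto simp: zeros_def)
qed

text \<open>A decomposable bivector is a nonzero multiple of the Pluecker vector of exactly one
  plane, so each common zero contributes q - 1 elements.\<close>

lemma card_zeros_annihilator:
  fixes D :: "(nat \<times> nat \<Rightarrow> 'a::{finite,field}) set"
  shows "card (zeros m D) * (CARD('a) - 1) = card (orth m D \<inter> decs m)"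
proof -
  let ?h = "\<lambda>(W, c). cscale c (plucker m W)"
  have "inj_on ?h (zeros m D \<times> (UNIV - {0}))"
  proof (rule inj_onI)
    fix p p' assume p: "p \<in> zeros m D \<times> (UNIV - {0})" "p' \<in> zeros m D \<times> (UNIV - {0})" and "?h p = ?h p'"
    moreover obtain W c W' c' where pp: "p = (W, c)" "p' = (W', c')" by (metis surj_pair)
    ultimately have W: "W \<in> zeros m D" "W' \<in> zeros m D" and c: "c \<noteq> 0" "c' \<noteq> 0"
      and eq: "cscale c (plucker m W) = cscale c' (plucker m W')" by auto
    have G: "W \<in> Gr2 m" "W' \<in> Gr2 m" using W by (auto simp: zeros_def)
    have "plucker m W = cscale (inverse c * c') (plucker m W')"
      using arg_cong[OF eq, of "cscale (inverse c)"] c by simp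
    moreover have "inverse c * c' \<noteq> 0" using c by simp
    ultimately have WW: "W = W'"
      using span2_eq_iff rep2[OF G(1)] rep2[OF G(2)] unfolding plucker_def by metis
    then have "c = c'" using eq rep2(3)[OF G(1)] by simp
    then show "p = p'" using WW pp by simp
  qed
  then have "card (?h ` (zeros m D \<times> (UNIV - {0}))) = card (zeros m D) * (CARD('a) - 1)"
    by (simp add: card_image card_cartesian_product)
  moreover have "?h ` (zeros m D \<times> (UNIV - {0})) = orth m D \<inter> decs m"
  proof (intro equalityI subsetI)
    fix B assume "B \<in> ?h ` (zeros m D \<times> (UNIV - {0}))"
    then obtain W c where B: "B = cscale c (plucker m W)" "c \<noteq> 0" "W \<in> Gr2 m" "\<forall>A\<in>D. pair m A (plucker m W) = 0"
      by (auto simp: zeros_def)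
    note r = rep2[OF B(3)]
    have "B = wedge (cscale c (fst (rep2 m W))) (snd (rep2 m W))" by (simp add: B wedge_scale_left plucker_def)
    then have "B \<in> decs m" using r B(1,2) fs.subspace_scale[OF subspace_vecs r(1)] unfolding decs_def by auto
    then show "B \<in> orth m D \<inter> decs m" using decs_alts B by (auto simp: orth_def pair_scale)
  next
    fix B assume "B \<in> orth m D \<inter> decs m"
    then obtain u v where uv: "B = wedge u v" "u \<in> vecs m" "v \<in> vecs m" "wedge u v \<noteq> 0" "\<forall>A\<in>D. pair m A (wedge u v) = 0"
      by (auto simp: decs_def orth_def)
    then obtain c where c: "c \<noteq> 0" "wedge u v = cscale c (plucker m (span2 u v))" using plucker_span2 by metis
    have "span2 u v \<in> zeros m D"
      using uv pair_plucker_eq_0_iff[OF uv(2,3,4)] by (auto simp: zeros_def Gr2_iff)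
    then have "(span2 u v, c) \<in> zeros m D \<times> (UNIV - {0})" using c(1) by simp
    moreover have "B = ?h (span2 u v, c)" using c(2) uv(1) by simp
    ultimately show "B \<in> ?h ` (zeros m D \<times> (UNIV - {0}))" by blast
  qed
  ultimately show ?thesis by simp
qed

(* Count the triples (A, x, y) with A(x, y) = 0 twice: by linearity in A the count is governed
   by the pairs killed by all of D, by linearity in y it is governed by the kernels. *)
lemma card_zeros_ker:
  fixes D :: "(nat \<times> nat \<Rightarrow> 'a::{finite,field}) set"
  assumes D: "D \<subseteq> alts m" "fs.subspace D" "card D = CARD('a) ^ m"
  shows "(card (Gr2 m :: (nat \<Rightarrow> 'a) set set) - card (zeros m D)) * ((CARD('a) ^ 2 - 1) * (CARD('a) ^ 2 - CARD('a)))
     + (\<Sum>A\<in>D. card (ker m A)) = CARD('a) ^ (2 * m)"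
proof -
  let ?q = "CARD('a)" and ?V = "vecs m :: (nat \<Rightarrow> 'a) set"
  have finD: "finite D" using D(1) finite_alts finite_subset by blast
  define Y where "Y = {p \<in> ?V \<times> ?V. \<forall>A\<in>D. (\<lambda>(x, y). bil m A x y) p = 0}"
  define T where "T = {(A, p) \<in> D \<times> (?V \<times> ?V). (\<lambda>(x, y). bil m A x y) p = 0}"
  have 1: "?q * card T = card D * (card (?V \<times> ?V) + (?q - 1) * card Y)"
    unfolding T_def Y_def
    by (rule double_count_zeros[OF D(2) finD]) (auto simp: finite_vecs bil_add_left bil_scale_left)
  define T' where "T' = {(y, p) \<in> ?V \<times> (D \<times> ?V). (\<lambda>(A, x). bil m A x y) p = 0}"
  \<comment> \<open>As \<open>dotp\<close> is nondegenerate on V, these are the pairs (A, x) with x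
    in the kernel of A.\<close>
  define K where "K = {p \<in> D \<times> ?V. \<forall>y\<in>?V. (\<lambda>(A, x). bil m A x y) p = 0}"
  have 2: "?q * card T' = card ?V * (card (D \<times> ?V) + (?q - 1) * card K)"
    unfolding T'_def K_def
    by (rule double_count_zeros[OF subspace_vecs finite_vecs])
      (auto simp: finite_vecs finD bil_add_right bil_scale_right)
  have "bij_betw (\<lambda>(A, x, y). (y, A, x)) T T'"
    by (rule bij_betw_byWitness[where f' = "\<lambda>(y, A, x). (A, x, y)"]) (auto simp: T_def T'_def)
  then have "card T = card T'" by (rule bij_betw_same_card)
  then have "card D * (card (?V \<times> ?V) + (?q - 1) * card Y) = card ?V * (card (D \<times> ?V) + (?q - 1) * card K)"
    using 1 2 by metis
  then have "?q ^ m * (?q ^ (2 * m) + (?q - 1) * card Y) = ?q ^ m * (?q ^ (2 * m) + (?q - 1) * card K)"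
    unfolding D(3) card_vecs card_cartesian_product mult_2 power_add .
  moreover have "?q ^ m \<noteq> 0" "?q - 1 \<noteq> 0" using CARD_field_ge_2[where 'a='a] by auto
  ultimately have YK: "card Y = card K" by (simp only: mult_left_cancel add_left_cancel simp_thms)
  have "K = (SIGMA A:D. ker m A)"
  proof (rule set_eqI, clarify)
    fix A x
    show "(A, x) \<in> K \<longleftrightarrow> (A, x) \<in> (SIGMA A:D. ker m A)"
      using dotp_eq_0_all[of "mul m A x" m] mul_vecs[of A m x] D(1)
      by (auto simp: K_def ker_def bil_def dotp_def)
  qed
  then have K: "card K = (\<Sum>A\<in>D. card (ker m A))" using finD by (simp add: finite_ker)
  let ?\<W> = "Gr2 m - zeros m D"
  \<comment> \<open>A dependent pair is killed by every form, so the pairs outside \<open>Y\<close>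
    are exactly the ordered bases of the planes in the support.\<close>
  have "{(x, y) \<in> ?V \<times> ?V. wedge x y \<noteq> 0 \<and> span2 x y \<in> ?\<W>} = ?V \<times> ?V - Y"
  proof (rule set_eqI, clarify)
    fix x y
    show "(x, y) \<in> {(x, y) \<in> ?V \<times> ?V. wedge x y \<noteq> 0 \<and> span2 x y \<in> ?\<W>} \<longleftrightarrow> (x, y) \<in> ?V \<times> ?V - Y"
    proof (cases "x \<in> ?V \<and> y \<in> ?V")
      case True
      then have xy: "x \<in> ?V" "y \<in> ?V" by auto
      have Y: "(x, y) \<in> Y \<longleftrightarrow> (\<forall>A\<in>D. pair m A (wedge x y) = 0)"
        using xy D(1) pair_wedge by (fastforce simp: Y_def)
      show ?thesis
      proof (cases "wedge x y = 0")
        case True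
        then have "(x, y) \<in> Y" unfolding Y by (simp add: pair_def)
        then show ?thesis using True by simp
      next
        case False
        then have "span2 x y \<in> Gr2 m" using xy Gr2_iff by blast
        then show ?thesis using xy False Y pair_plucker_eq_0_iff[OF xy False] by (auto simp: zeros_def)
      qed
    qed auto
  qed
  then have "card ?\<W> * ((?q ^ 2 - 1) * (?q ^ 2 - ?q)) = card (?V \<times> ?V - Y)"
    using card_pairs_spanning[of ?\<W> m] by simp
  also have "\<dots> + card Y = card (?V \<times> ?V)"
  proof -
    have "Y \<subseteq> ?V \<times> ?V" by (auto simp: Y_def)
    moreover have "finite (?V \<times> ?V)" by (simp add: finite_vecs)
    ultimately show ?thesis by (metis card_Diff_subset card_mono finite_subset le_add_diff_inverse2)
  qed
  finally have "card ?\<W> * ((?q ^ 2 - 1) * (?q ^ 2 - ?q)) + card Y = ?q ^ (2 * m)"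
    by (simp add: card_cartesian_product card_vecs mult_2 power_add)
  moreover have "card ?\<W> = card (Gr2 m :: (nat \<Rightarrow> 'a) set set) - card (zeros m D)"
    by (rule card_Diff_subset) (auto simp: zeros_def finite_Gr2)
  ultimately show ?thesis by (simp add: YK K)
qed

section \<open>The extremal space and the two weights\<close>

text \<open>A complement of the line of e_0, on which x is determined by e_0 wedge x.\<close>

definition vecs0 :: "nat \<Rightarrow> (nat \<Rightarrow> 'a::field) set" where
  "vecs0 m = {x \<in> vecs m. x 0 = 0}"

definition extremal_vec :: "(nat \<Rightarrow> 'a::field) \<times> 'a \<Rightarrow> nat \<times> nat \<Rightarrow> 'a" where
  "extremal_vec = (\<lambda>(x, c). wedge (unitv 0) x + cscale c (wedge (unitv 1) (unitv 2)))"

definition extremal :: "nat \<Rightarrow> (nat \<times> nat \<Rightarrow> 'a::field) set" where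
  "extremal m = extremal_vec ` (vecs0 m \<times> UNIV)"

lemma subspace_vecs0: "fs.subspace (vecs0 m)"
  by (rule fs.subspaceI) (auto simp: vecs0_def vecs_def cscale_def)

lemma card_vecs0:
  assumes "m \<ge> 1"
  shows "card (vecs0 m :: (nat \<Rightarrow> 'a::{finite,field}) set) = CARD('a) ^ (m - 1)"
proof -
  have "card (vecs m :: (nat \<Rightarrow> 'a) set) = CARD('a) * card (vecs0 m :: (nat \<Rightarrow> 'a) set)"
    unfolding vecs0_def
    by (rule card_functional_kernel[OF subspace_vecs, of _ _ "unitv 0"])
      (use assms in \<open>auto simp: cscale_def unitv_def vecs_def\<close>)
  moreover have "CARD('a) ^ m = CARD('a) * CARD('a) ^ (m - 1)"
    using assms by (cases m) auto
  ultimately show ?thesis by (simp add: card_vecs)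
qed

text \<open>Row 0 of the matrix returns x. The entry (1, 2), to which e_0 wedge x contributes
  nothing, returns c.\<close>

lemma inj_extremal_vec: "inj_on extremal_vec (vecs0 m \<times> UNIV)"
proof (rule inj_onI)
  fix p p' :: "(nat \<Rightarrow> 'a) \<times> 'a"
  assume p: "p \<in> vecs0 m \<times> UNIV" "p' \<in> vecs0 m \<times> UNIV" and eq: "extremal_vec p = extremal_vec p'"
  obtain x c x' c' where pp: "p = (x, c)" "p' = (x', c')" by (metis surj_pair)
  have x0: "x 0 = 0" "x' 0 = 0" using p by (auto simp: pp vecs0_def)
  have "x j = x' j" for j
    using fun_cong[OF eq, of "(0, j)"] x0 by (simp add: pp extremal_vec_def wedge_apply unitv_def cscale_def split: if_splits)
  then have xx: "x = x'" by blast
  then have "c = c'"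
    using fun_cong[OF eq, of "(1, 2)"] by (simp add: pp extremal_vec_def wedge_apply unitv_def cscale_def)
  then show "p = p'" using xx pp by simp
qed

lemma card_extremal: "m \<ge> 1 \<Longrightarrow> card (extremal m :: (nat \<times> nat \<Rightarrow> 'a::{finite,field}) set) = CARD('a) ^ m"
  unfolding extremal_def card_image[OF inj_extremal_vec]
  by (cases m) (simp_all add: card_cartesian_product card_vecs0)

lemma subspace_extremal: "fs.subspace (extremal m)"
proof (rule fs.subspaceI)
  note s = subspace_vecs0[of m, where 'a='a]
  have e: "extremal_vec (x + y, c + d) = extremal_vec (x, c) + extremal_vec (y, d)"
    "extremal_vec (cscale k x, k * c) = cscale k (extremal_vec (x, c))" for x y :: "nat \<Rightarrow> 'a" and c d k
    by (simp_all add: extremal_vec_def wedge_add_right wedge_scale_right fs.scale_left_distrib fs.scale_right_distrib algebra_simps)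
  show "(0 :: nat \<times> nat \<Rightarrow> 'a) \<in> extremal m" unfolding extremal_def
    by (rule image_eqI[of _ _ "(0, 0)"]) (auto simp: extremal_vec_def wedge_zero_right fs.subspace_0[OF s])
  show "A + B \<in> extremal m" if "A \<in> extremal m" "B \<in> extremal m" for A B :: "nat \<times> nat \<Rightarrow> 'a"
    using that fs.subspace_add[OF s] unfolding extremal_def by (auto simp flip: e(1))
  show "cscale k A \<in> extremal m" if "A \<in> extremal m" for k and A :: "nat \<times> nat \<Rightarrow> 'a"
    using that fs.subspace_scale[OF s] unfolding extremal_def by (auto simp flip: e(2))
qed

lemma extremal_alts: "m \<ge> 3 \<Longrightarrow> extremal m \<subseteq> alts m"
  unfolding extremal_def extremal_vec_def vecs0_def
  by (auto intro!: fs.subspace_add[OF subspace_alts] fs.subspace_scale[OF subspace_alts] wedge_alts)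

text \<open>\<open>P1\<close> parametrises the nonzero e_0 wedge x. \<open>P2\<close> has c nonzero
  and x in <e_1, e_2>; its bivectors live on <e_0, e_1, e_2>, and in three dimensions every bivector
  factors. \<open>card_decs_le\<close> is the matching upper bound.\<close>

lemma card_extremal_decs_ge:
  assumes m: "m \<ge> 3"
  shows "CARD('a) ^ (m - 1) + CARD('a) ^ 3 \<le> card (extremal m \<inter> decs m :: (nat \<times> nat \<Rightarrow> 'a::{finite,field}) set) + CARD('a) ^ 2 + 1"
proof -
  let ?q = "CARD('a)"
  let ?e0 = "unitv 0 :: nat \<Rightarrow> 'a" and ?e1 = "unitv 1 :: nat \<Rightarrow> 'a" and ?e2 = "unitv 2 :: nat \<Rightarrow> 'a"
  have e: "?e0 \<in> vecs m" "?e1 \<in> vecs m" "?e2 \<in> vecs m" using m by auto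
  define P1 :: "((nat \<Rightarrow> 'a) \<times> 'a) set" where "P1 = (vecs0 m - {0}) \<times> {0}"
  define P2 :: "((nat \<Rightarrow> 'a) \<times> 'a) set" where "P2 = span2 ?e1 ?e2 \<times> (UNIV - {0})"
  have w12: "wedge ?e1 ?e2 (1, 2) = 1" by (simp add: wedge_apply unitv_def)
  have w: "wedge ?e1 ?e2 \<noteq> 0"
  proof
    assume "wedge ?e1 ?e2 = 0"
    then show False using w12 by simp
  qed
  have s12: "span2 ?e1 ?e2 \<subseteq> vecs0 m"
    by (rule span2_subset[OF subspace_vecs0]) (use e in \<open>auto simp: vecs0_def unitv_def\<close>)
  have P: "P1 \<union> P2 \<subseteq> vecs0 m \<times> UNIV" using s12 by (auto simp: P1_def P2_def)
  have fin0: "finite (vecs0 m :: (nat \<Rightarrow> 'a) set)" 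
    by (rule finite_subset[OF _ finite_vecs[of m]]) (auto simp: vecs0_def)
  have "card (P1 \<union> P2) = card P1 + card P2"
  proof (rule card_Un_disjoint)
    show "finite P1" unfolding P1_def using fin0 by simp
    show "finite P2" unfolding P2_def by (intro finite_cartesian_product card_span2(1)[OF w]) simp
  qed (auto simp: P1_def P2_def)
  also have "card P1 = ?q ^ (m - 1) - 1"
    using m fs.subspace_0[OF subspace_vecs0[of m, where 'a='a]] fin0 by (simp add: P1_def card_cartesian_product card_vecs0)
  also have "card P2 = ?q ^ 2 * (?q - 1)"
    unfolding P2_def card_cartesian_product card_span2(2)[OF w] by simp
  finally have cardP: "card (P1 \<union> P2) = (?q ^ (m - 1) - 1) + ?q ^ 2 * (?q - 1)" .
  have "extremal_vec ` (P1 \<union> P2) \<subseteq> extremal m \<inter> decs m"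
  proof (intro subsetI IntI)
    fix A assume A: "A \<in> extremal_vec ` (P1 \<union> P2)"
    then show "A \<in> extremal m" using P unfolding extremal_def by blast
    from A obtain p where p: "p \<in> P1 \<union> P2" "A = extremal_vec p" by blast
    have "(0, 0) \<in> vecs0 m \<times> (UNIV :: 'a set)" using fs.subspace_0[OF subspace_vecs0] by blast
    moreover have "extremal_vec (0, 0 :: 'a) = 0" by (simp add: extremal_vec_def wedge_zero_right)
    moreover have "p \<noteq> (0, 0)" using p(1) by (auto simp: P1_def P2_def)
    ultimately have nz: "A \<noteq> 0" using p P inj_onD[OF inj_extremal_vec, of p "(0, 0)" m] by auto
    have "\<exists>u\<in>vecs m. \<exists>v\<in>vecs m. A = wedge u v"
    proof (cases "p \<in> P1")
      case True
      then obtain x where "x \<in> vecs m" "p = (x, 0)" by (auto simp: P1_def vecs0_def)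
      then have "A = wedge ?e0 x" by (simp add: p(2) extremal_vec_def)
      then show ?thesis using e(1) \<open>x \<in> vecs m\<close> by blast
    next
      case False
      then obtain b c d where d: "d \<noteq> 0" and pd: "p = (cscale b ?e1 + cscale c ?e2, d)"
        using p(1) by (auto simp: P2_def span2_alt)
      \<comment> \<open>The factorisation of d e_1 wedge e_2 + b e_0 wedge e_1 + c e_0 wedge e_2
        uses that d is invertible.\<close>
      have "A = wedge (cscale d ?e1 + cscale c ?e0) (?e2 + cscale (- (b / d)) ?e0)"
        using d by (auto simp: p(2) pd extremal_vec_def wedge_def fun_eq_iff cscale_def algebra_simps)
      moreover have "cscale d ?e1 + cscale c ?e0 \<in> vecs m" "?e2 + cscale (- (b / d)) ?e0 \<in> vecs m"
        by (intro fs.subspace_add[OF subspace_vecs] fs.subspace_scale[OF subspace_vecs] e)+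
      ultimately show ?thesis by blast
    qed
    then show "A \<in> decs m" using nz by (simp add: decs_def)
  qed
  moreover have "finite (extremal m \<inter> decs m :: (nat \<times> nat \<Rightarrow> 'a) set)" unfolding extremal_def using fin0 by simp
  ultimately have "card (extremal_vec ` (P1 \<union> P2)) \<le> card (extremal m \<inter> decs m :: (nat \<times> nat \<Rightarrow> 'a) set)"
    by (intro card_mono)
  moreover have "card (extremal_vec ` (P1 \<union> P2)) = card (P1 \<union> P2)"
    by (rule card_image[OF inj_on_subset[OF inj_extremal_vec P]])
  ultimately have le: "(?q ^ (m - 1) - 1) + ?q ^ 2 * (?q - 1) \<le> card (extremal m \<inter> decs m :: (nat \<times> nat \<Rightarrow> 'a) set)"
    by (simp add: cardP)
  have q: "?q \<ge> 2" by (rule CARD_field_ge_2)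
  then have "?q ^ (m - 1) \<ge> 1" by simp
  moreover have "?q ^ 2 * (?q - 1) + ?q ^ 2 = ?q ^ 3"
  proof -
    obtain r where "?q = r + 1" using q by (metis le_add_diff_inverse2 one_le_numeral order_trans)
    then show ?thesis by (simp add: power2_eq_square power3_eq_cube algebra_simps)
  qed
  ultimately show ?thesis using le by linarith
qed

section \<open>The weight in dimension m\<close>

lemma sum_split_decs:
  fixes D :: "(nat \<times> nat \<Rightarrow> 'a::{finite,field}) set" and f :: "_ \<Rightarrow> nat"
  assumes D: "fs.subspace D" "finite D"
  shows "sum f D = f 0 + sum f (D \<inter> decs m) + sum f (D - decs m - {0})"
    and "card D = 1 + card (D \<inter> decs m) + card (D - decs m - {0})"
proof -
  have *: "sum g D = g 0 + sum g (D \<inter> decs m) + sum g (D - decs m - {0})" for g :: "_ \<Rightarrow> nat"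
  proof -
    have "sum g D = sum g (D - decs m) + sum g (D \<inter> decs m)"
      using sum.Int_Diff[OF D(2), of g "decs m"] by simp
    moreover have "0 \<in> D - decs m" using fs.subspace_0[OF D(1)] by (simp add: decs_def)
    then have "sum g (D - decs m) = g 0 + sum g (D - decs m - {0})"
      using D(2) by (simp add: sum.remove)
    ultimately show ?thesis by simp
  qed
  show "sum f D = f 0 + sum f (D \<inter> decs m) + sum f (D - decs m - {0})" by (rule *)
  show "card D = 1 + card (D \<inter> decs m) + card (D - decs m - {0})"
    using *[of "\<lambda>_. 1"] by simp
qed

lemma geometric_sum_rev:
  fixes q :: int
  assumes "k \<le> d + 1"
  shows "(q - 1) * (\<Sum>j<k. q ^ (d - j)) = q ^ (d + 1) - q ^ (d + 1 - k)"
  using assms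
proof (induction k)
  case (Suc k)
  then have "d + 1 - k = Suc (d - k)" "d + 1 - Suc k = d - k" by auto
  then show ?case using Suc by (simp add: algebra_simps)
qed simp

text \<open>With Q = q^(m-4) the dependence on m leaves the exponents and the final count is a
  polynomial identity. Here s is the geometric sum in the weight, and the summand with factor Q is
  the extremal kernel sum.\<close>

lemma weight_identity:
  fixes q Q s :: int
  assumes "(q - 1) * s = Q ^ 2 * q ^ 5 - Q * q ^ 2"
  shows "(s + Q ^ 2 * q ^ 2) * ((q ^ 2 - 1) * (q ^ 2 - q)) + Q * (Q * q ^ 5 + Q * q ^ 4 - Q * q ^ 3 + q ^ 5 - q ^ 3)
     = Q ^ 2 * q ^ 8"
proof -
  have "s * ((q ^ 2 - 1) * (q ^ 2 - q)) = ((q - 1) * s) * (q * (q ^ 2 - 1))"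
    by algebra
  also have "\<dots> = (Q ^ 2 * q ^ 5 - Q * q ^ 2) * (q * (q ^ 2 - 1))" using assms by simp
  finally have *: "s * ((q ^ 2 - 1) * (q ^ 2 - q)) = (Q ^ 2 * q ^ 5 - Q * q ^ 2) * (q * (q ^ 2 - 1))" .
  show ?thesis unfolding distrib_right * by algebra
qed

lemma higher_weight_dim:
  assumes m: "m \<ge> 4"
  shows "higher_weight (grass_code2 m :: ((nat \<Rightarrow> 'a::{finite,field}) set \<Rightarrow> 'a) set) m
    = (\<Sum>j<m - 1. CARD('a) ^ (2 * (m - 2) - j)) + CARD('a) ^ (2 * (m - 2) - 2)"
proof -
  let ?q = "CARD('a)" and ?G = "card (Gr2 m :: (nat \<Rightarrow> 'a) set set)"
  obtain t where t: "m = t + 4" using m by (metis le_add_diff_inverse2)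
  define Q where "Q = ?q ^ t"
  define s where "s = (\<Sum>j<m - 1. ?q ^ (2 * (m - 2) - j))"
  define w where "w = s + ?q ^ (2 * (m - 2) - 2)"
  define P where "P = (?q ^ 2 - 1) * (?q ^ 2 - ?q)"
  have q: "?q \<ge> 2" by (rule CARD_field_ge_2)
  have qm: "?q ^ m = Q * ?q ^ 4" by (simp add: t Q_def power_add)
  have qm1: "?q ^ (m - 1) = Q * ?q ^ 3" by (simp add: t Q_def power_add eval_nat_numeral)
  have q2m: "?q ^ (2 * m) = Q ^ 2 * ?q ^ 8" by (simp add: t Q_def power_add mult_2 power2_eq_square eval_nat_numeral)
  have ge: "?q \<le> ?q ^ 2" "1 \<le> ?q ^ 2" "?q ^ 1 < ?q ^ 2" using q by (auto simp: power2_eq_square)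
  have P0: "P > 0" using ge q by (simp add: P_def)
  have Pint: "int P = (int ?q ^ 2 - 1) * (int ?q ^ 2 - int ?q)"
    using ge by (simp add: P_def of_nat_diff)
  \<comment> \<open>The kernel sum of a space with the maximal number of decomposables, each with
    kernel size Q q^2, and kernel size Q for the other nonzero forms; \<open>Zeq\<close> exhibits it
    in that shape.\<close>
  define Z where "Z = int Q * (int Q * int ?q ^ 5 + int Q * int ?q ^ 4 - int Q * int ?q ^ 3 + int ?q ^ 5 - int ?q ^ 3)"
  have wZ: "int w * int P + Z = int (?q ^ (2 * m))"
  proof -
    have "(int ?q - 1) * int s = int ?q ^ (2 * (m - 2) + 1) - int ?q ^ (2 * (m - 2) + 1 - (m - 1))"
      unfolding s_def using geometric_sum_rev[of "m - 1" "2 * (m - 2)" "int ?q"] m by simp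
    also have "2 * (m - 2) + 1 = t + t + 5" using t by simp
    also have "t + t + 5 - (m - 1) = t + 2" using t by simp
    finally have "(int ?q - 1) * int s = int Q ^ 2 * int ?q ^ 5 - int Q * int ?q ^ 2"
      by (simp add: Q_def power_add power2_eq_square power_even_eq)
    from weight_identity[OF this]
    have "(int s + int Q ^ 2 * int ?q ^ 2) * int P + Z = int Q ^ 2 * int ?q ^ 8" unfolding Pint Z_def .
    moreover have "int w = int s + int Q ^ 2 * int ?q ^ 2"
      by (simp add: w_def t Q_def power_add mult_2 power2_eq_square)
    ultimately show ?thesis by (simp add: q2m)
  qed
  have Zeq: "Z = int Q * (int ?q ^ 4 + (int Q * int ?q ^ 3 + int ?q ^ 3 - int ?q ^ 2 - 1) * (int ?q ^ 2 - 1) + int Q * int ?q ^ 4 - 1)"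
    unfolding Z_def by algebra
  have split: "(\<Sum>A\<in>D. card (ker m A)) = Q * ?q ^ 4 + (\<Sum>A\<in>D \<inter> decs m. card (ker m A))
      + (\<Sum>A\<in>D - decs m - {0}. card (ker m A))" "Q * ?q ^ 4 = 1 + card (D \<inter> decs m) + card (D - decs m - {0})"
    if "D \<subseteq> alts m" "fs.subspace D" "card D = ?q ^ m" for D :: "(nat \<times> nat \<Rightarrow> 'a) set"
  proof -
    have fin: "finite D" using that(1) finite_alts finite_subset by blast
    show "(\<Sum>A\<in>D. card (ker m A)) = Q * ?q ^ 4 + (\<Sum>A\<in>D \<inter> decs m. card (ker m A))
      + (\<Sum>A\<in>D - decs m - {0}. card (ker m A))"
      using sum_split_decs(1)[OF that(2) fin, of "\<lambda>A. card (ker m A)" m] by (simp add: ker_0 card_vecs qm)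
    show "Q * ?q ^ 4 = 1 + card (D \<inter> decs m) + card (D - decs m - {0})"
      using sum_split_decs(2)[OF that(2) fin, of m] that(3) qm by simp
  qed
  \<comment> \<open>Each decomposable missing from the maximum costs Q (q^2 - 1) against
    \<open>Z\<close>.\<close>
  have arith: "int (Q * ?q ^ 4 + N * (Q * ?q ^ 2) + R * Q)
      = Z - int Q * ((int Q * int ?q ^ 3 + int ?q ^ 3 - int ?q ^ 2 - 1 - int N) * (int ?q ^ 2 - 1))"
    if "Q * ?q ^ 4 = 1 + N + R" for N R
  proof -
    have R: "int R = int Q * int ?q ^ 4 - 1 - int N" using arg_cong[OF that, of int] by simp
    show ?thesis unfolding Zeq of_nat_add of_nat_mult of_nat_power R by algebra
  qed
  have q21: "int ?q ^ 2 - 1 \<ge> 0" using ge by (metis of_nat_1 of_nat_diff of_nat_0_le_iff of_nat_power)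
  have lower: "w \<le> ?G - card (zeros m D)"
    if D: "D \<subseteq> alts m" "fs.subspace D" "card D = ?q ^ m" for D :: "(nat \<times> nat \<Rightarrow> 'a) set"
  proof -
    have fin: "finite D" using D(1) finite_alts finite_subset by blast
    have 1: "card (ker m A) \<le> Q * ?q ^ 2" if "A \<in> D \<inter> decs m" for A
    proof -
      have "card (ker m A) * ?q ^ 2 \<le> (Q * ?q ^ 2) * ?q ^ 2"
        using card_ker_nonzero[of A m] that D(1) qm by (auto simp: decs_def eval_nat_numeral)
      then show ?thesis using q by simp
    qed
    have 2: "card (ker m A) \<le> Q" if "A \<in> D - decs m - {0}" for A
    proof -
      have "card (ker m A) * ?q ^ 4 \<le> Q * ?q ^ 4"
        using card_ker_not_decs[of A m] that D(1) qm by auto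
      then show ?thesis using q by simp
    qed
    have "(\<Sum>A\<in>D. card (ker m A)) \<le> Q * ?q ^ 4 + card (D \<inter> decs m) * (Q * ?q ^ 2) + card (D - decs m - {0}) * Q"
      unfolding split(1)[OF D]
      using sum_bounded_above[of "D \<inter> decs m" "\<lambda>A. card (ker m A)", OF 1]
        sum_bounded_above[of "D - decs m - {0}" "\<lambda>A. card (ker m A)", OF 2] by simp
    then have "int (\<Sum>A\<in>D. card (ker m A)) \<le> int (Q * ?q ^ 4 + card (D \<inter> decs m) * (Q * ?q ^ 2) + card (D - decs m - {0}) * Q)"
      by (rule zle_int[THEN iffD2])
    also have "\<dots> \<le> Z"
    proof -
      have "card (D \<inter> decs m) + ?q ^ 2 + 1 \<le> Q * ?q ^ 3 + ?q ^ 3"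
        using card_decs_le[OF D(2) fin D(3)] m qm1 by simp
      then have "int (card (D \<inter> decs m) + ?q ^ 2 + 1) \<le> int (Q * ?q ^ 3 + ?q ^ 3)" by (rule zle_int[THEN iffD2])
      then have "0 \<le> int Q * int ?q ^ 3 + int ?q ^ 3 - int ?q ^ 2 - 1 - int (card (D \<inter> decs m))" by simp
      then show ?thesis unfolding arith[OF split(2)[OF D]] using q21 by (simp add: mult_nonneg_nonneg)
    qed
    finally have "int (\<Sum>A\<in>D. card (ker m A)) \<le> Z" .
    moreover have "int (?G - card (zeros m D)) * int P + int (\<Sum>A\<in>D. card (ker m A)) = int (?q ^ (2 * m))"
      using arg_cong[OF card_zeros_ker[OF D], of int] unfolding P_def of_nat_add of_nat_mult .
    ultimately have "int w * int P \<le> int (?G - card (zeros m D)) * int P" using wZ by linarith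
    then show ?thesis using P0 by simp
  qed
  have m3: "m \<ge> 3" "m \<ge> 1" using m by auto
  note E = extremal_alts[OF m3(1), where 'a='a] subspace_extremal[of m, where 'a='a] card_extremal[OF m3(2), where 'a='a]
  have upper: "?G - card (zeros m (extremal m :: (nat \<times> nat \<Rightarrow> 'a) set)) \<le> w"
  proof -
    let ?D = "extremal m :: (nat \<times> nat \<Rightarrow> 'a) set"
    have 1: "card (ker m A) \<ge> Q * ?q ^ 2" if "A \<in> ?D \<inter> decs m" for A
    proof -
      have "A \<in> decs m" using that by blast
      then obtain u v where "A = wedge u v" unfolding decs_def by blast
      then have "(Q * ?q ^ 2) * ?q ^ 2 \<le> card (ker m A) * ?q ^ 2"
        using card_ker_wedge[of m u v] qm by (simp add: eval_nat_numeral ac_simps)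
      then show ?thesis using q by simp
    qed
    \<comment> \<open>Every element of the extremal space is a sum of two decomposables, so its
      other nonzero forms have rank exactly 4 and the estimates of \<open>lower\<close> are
      attained.\<close>
    have 2: "card (ker m A) \<ge> Q" if A: "A \<in> ?D - decs m - {0}" for A
    proof -
      obtain x c where "A = wedge (unitv 0) x + wedge (cscale c (unitv 1)) (unitv 2)"
        using A by (auto simp: extremal_def extremal_vec_def wedge_scale_left)
      then have "Q * ?q ^ 4 \<le> card (ker m A) * ?q ^ 4"
        using card_ker_wedge_add[of m] qm by (metis mult.commute)
      then show ?thesis using q by simp
    qed
    have "Q * ?q ^ 4 + card (?D \<inter> decs m) * (Q * ?q ^ 2) + card (?D - decs m - {0}) * Q \<le> (\<Sum>A\<in>?D. card (ker m A))"
      unfolding split(1)[OF E]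
      using sum_bounded_below[of "?D \<inter> decs m" "Q * ?q ^ 2" "\<lambda>A. card (ker m A)", OF 1]
        sum_bounded_below[of "?D - decs m - {0}" Q "\<lambda>A. card (ker m A)", OF 2] by simp
    then have "int (Q * ?q ^ 4 + card (?D \<inter> decs m) * (Q * ?q ^ 2) + card (?D - decs m - {0}) * Q) \<le> int (\<Sum>A\<in>?D. card (ker m A))"
      by (rule zle_int[THEN iffD2])
    moreover have "Z \<le> int (Q * ?q ^ 4 + card (?D \<inter> decs m) * (Q * ?q ^ 2) + card (?D - decs m - {0}) * Q)"
    proof -
      have "Q * ?q ^ 3 + ?q ^ 3 \<le> card (?D \<inter> decs m) + ?q ^ 2 + 1"
        using card_extremal_decs_ge[OF m3(1), where 'a='a] qm1 by simp
      then have "int (Q * ?q ^ 3 + ?q ^ 3) \<le> int (card (?D \<inter> decs m) + ?q ^ 2 + 1)" by (rule zle_int[THEN iffD2])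
      then have "int Q * int ?q ^ 3 + int ?q ^ 3 - int ?q ^ 2 - 1 - int (card (?D \<inter> decs m)) \<le> 0" by simp
      then have "int Q * ((int Q * int ?q ^ 3 + int ?q ^ 3 - int ?q ^ 2 - 1 - int (card (?D \<inter> decs m))) * (int ?q ^ 2 - 1)) \<le> 0"
        by (intro mult_nonneg_nonpos mult_nonpos_nonneg q21) simp_all
      then show ?thesis unfolding arith[OF split(2)[OF E]] by simp
    qed
    moreover have "int (?G - card (zeros m ?D)) * int P + int (\<Sum>A\<in>?D. card (ker m A)) = int (?q ^ (2 * m))"
      using arg_cong[OF card_zeros_ker[OF E], of int] unfolding P_def of_nat_add of_nat_mult .
    ultimately have "int (?G - card (zeros m ?D)) * int P \<le> int w * int P" using wZ by linarith
    then show ?thesis using P0 by simp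
  qed
  have wG: "w \<le> ?G" using lower[OF E] by simp
  have "higher_weight (grass_code2 m :: ((nat \<Rightarrow> 'a) set \<Rightarrow> 'a) set) m = ?G - (?G - w)"
  proof (rule higher_weight_eqI(1)[OF E])
    show "?G - w \<le> card (zeros m (extremal m :: (nat \<times> nat \<Rightarrow> 'a) set))" using upper by linarith
    fix D :: "(nat \<times> nat \<Rightarrow> 'a) set"
    assume D: "D \<subseteq> alts m" "fs.subspace D" "card D = ?q ^ m"
    have "card (zeros m D) \<le> ?G" by (rule card_mono[OF finite_Gr2]) (auto simp: zeros_def)
    then show "card (zeros m D) \<le> ?G - w" using lower[OF D] wG by linarith
  qed
  then show ?thesis using wG by (simp add: w_def s_def)
qed

section \<open>The weight in codimension m\<close>

lemma card_orth:
  fixes D :: "(nat \<times> nat \<Rightarrow> 'a::{finite,field}) set"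
  assumes D: "D \<subseteq> alts m" "fs.subspace D" "card D = CARD('a) ^ r" and r: "r \<le> m choose 2"
  shows "card (orth m D) = CARD('a) ^ ((m choose 2) - r)"
proof -
  have "card D * card (orth m D) = card (alts m :: (nat \<times> nat \<Rightarrow> 'a) set)"
    unfolding orth_def
    by (rule card_annihilator[OF D(2) finite_subset[OF D(1) finite_alts] subspace_alts finite_alts])
      (use D(1) pair_eq_0_all in \<open>auto simp: pair_add pair_scale pair_add_left pair_scale_left\<close>)
  then have "CARD('a) ^ r * card (orth m D) = CARD('a) ^ r * CARD('a) ^ ((m choose 2) - r)"
    using r by (simp add: D(3) card_alts flip: power_add)
  then show ?thesis by simp
qed

lemma higher_weight_codim:
  assumes m: "m \<ge> 4"
  defines "z \<equiv> (\<Sum>j<m - 1. CARD('a) ^ j) + CARD('a) ^ 2"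
  shows "higher_weight (grass_code2 m :: ((nat \<Rightarrow> 'a::{finite,field}) set \<Rightarrow> 'a) set) ((m choose 2) - m)
    = card (Gr2 m :: (nat \<Rightarrow> 'a) set set) - z"
    and "z \<le> card (Gr2 m :: (nat \<Rightarrow> 'a) set set)"
proof -
  let ?q = "CARD('a)" and ?r = "(m choose 2) - m"
  have q: "?q \<ge> 2" by (rule CARD_field_ge_2)
  have m3: "m \<ge> 3" "m \<ge> 1" using m by auto
  \<comment> \<open>This makes the truncated difference (m choose 2) - m a true codimension.\<close>
  have "2 * m \<le> m * (m - 1)" using m by (simp add: mult.commute mult_le_mono2)
  from div_le_mono[OF this, of 2] have mk: "m \<le> m choose 2" by (simp add: choose_two)
  \<comment> \<open>z (q - 1) is the maximal number of nonzero decomposables: the geometric sum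
    gives q^(m-1) - 1, and the extra q^2 gives q^3 - q^2.\<close>
  have z: "z * (?q - 1) + ?q ^ 2 + 1 = ?q ^ (m - 1) + ?q ^ 3"
  proof -
    obtain p where p: "?q = p + 1" using q by (metis le_add_diff_inverse2 one_le_numeral order_trans)
    have "(\<Sum>j<k. (p + 1) ^ j) * p + 1 = (p + 1) ^ k" for k
      by (induction k) (simp_all add: algebra_simps)
    from this[of "m - 1"] show ?thesis unfolding z_def p
      by (simp add: algebra_simps power2_eq_square power3_eq_cube)
  qed
  note E = extremal_alts[OF m3(1), where 'a='a] subspace_extremal[of m, where 'a='a] card_extremal[OF m3(2), where 'a='a]
  let ?D0 = "orth m (extremal m :: (nat \<times> nat \<Rightarrow> 'a) set)"
  have "z * (?q - 1) \<le> card (extremal m \<inter> decs m :: (nat \<times> nat \<Rightarrow> 'a) set)"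
    using z card_extremal_decs_ge[OF m3(1), where 'a='a] by linarith
  \<comment> \<open>The extremal space lies in its double orthogonal, and the inclusion suffices for
    a lower bound.\<close>
  also have "\<dots> \<le> card (orth m ?D0 \<inter> decs m)"
    by (rule card_mono) (use E(1) finite_alts[of m, where 'a='a] in \<open>auto simp: orth_def pair_commute\<close>)
  also have "\<dots> = card (zeros m ?D0) * (?q - 1)" using card_zeros_annihilator[of m ?D0] by simp
  finally have z0: "z \<le> card (zeros m ?D0)" using q by simp
  have max: "card (zeros m D) \<le> z" if D: "D \<subseteq> alts m" "fs.subspace D" "card D = ?q ^ ?r"
    for D :: "(nat \<times> nat \<Rightarrow> 'a) set"
  proof -
    have co: "card (orth m D) = ?q ^ m" using card_orth[OF D] mk by simp
    have "card (orth m D \<inter> decs m) + ?q ^ 2 + 1 \<le> ?q ^ (m - 1) + ?q ^ 3"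
      by (rule card_decs_le[OF subspace_orth finite_subset[OF orth_alts finite_alts] co m3(2)])
    then have "card (zeros m D) * (?q - 1) \<le> z * (?q - 1)"
      using z card_zeros_annihilator[of m D] by simp
    then show ?thesis using q by simp
  qed
  note h = higher_weight_eqI[OF orth_alts subspace_orth card_orth[OF E mk] z0 max]
  show "higher_weight (grass_code2 m :: ((nat \<Rightarrow> 'a::{finite,field}) set \<Rightarrow> 'a) set) ?r
    = card (Gr2 m :: (nat \<Rightarrow> 'a) set set) - z" by (rule h(1))
  show "z \<le> card (Gr2 m :: (nat \<Rightarrow> 'a) set set)" by (rule h(2))
qed

theorem theorem6p8:
  fixes m :: nat
  assumes "m > 4"
  defines "q \<equiv> card (UNIV :: 'a::{finite,field} set)"
      and "k \<equiv> m choose 2"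
      and "n \<equiv> gauss_binom (card (UNIV :: 'a set)) m 2"
      and "\<delta> \<equiv> 2 * (m - 2)"
      and "\<mu> \<equiv> m - 1"
  shows "int (higher_weight (grass_code2 m :: ((nat \<Rightarrow> 'a) set \<Rightarrow> 'a) set) (k - \<mu> - 1))
           = int n - int ((\<Sum>j<\<mu>. q ^ j) + q ^ 2)
       \<and> higher_weight (grass_code2 m :: ((nat \<Rightarrow> 'a) set \<Rightarrow> 'a) set) (\<mu> + 1)
           = (\<Sum>j<\<mu>. q ^ (\<delta> - j)) + q ^ (\<delta> - 2)"
proof -
  have m: "m \<ge> 4" "\<mu> + 1 = m" "k - \<mu> - 1 = (m choose 2) - m"
    using assms(1) by (auto simp: \<mu>_def k_def)
  \<comment> \<open>The second part of \<open>c\<close> says that the subtraction of natural numbers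
    does not truncate, which gives the integer form of the first claim.\<close>
  note c = higher_weight_codim[OF m(1), where 'a='a]
  show ?thesis
    unfolding m(2,3) using higher_weight_dim[OF m(1), where 'a='a] c
    by (simp add: q_def n_def \<delta>_def \<mu>_def of_nat_diff flip: card_Gr2)
qed

end
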